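(* Let $\equiv$ be a congruence on terms and propositions of a (possibly many-sorted) first-order language, defined by a confluent rewrite system rewriting terms to terms and atomic propositions to propositions, and assume that the theory defined by $\equiv$ is super-consistent. Then for every context $\Gamma$ and proposition $B$: if the sequent $\Gamma\vdash B$ is provable in natural deduction modulo $\equiv$, then $\Gamma\vdash B$ has a cut-free proof.
   Context: Propositions are built from atomic propositions, $\top,\bot$, $\Rightarrow,\wedge,\vee$, $\forall x$, $\exists x$. A context is a finite sequence of propositions; a sequent is $\Gamma\vdash C$. Natural deduction modulo $\equiv$ has the rules: axiom: $\Gamma\vdash B$ if $B\equiv A$ for some $A$ in $\Gamma$; $\Rightarrow_i$: from $\Gamma,A\vdash B$ infer $\Gamma\vdash C$ if $C\equiv A\Rightarrow B$; $\Rightarrow_e$: from $\Gamma\vdash C$ and $\Gamma\vdash A$ infer $\Gamma\vdash B$ if $C\equiv A\Rightarrow B$; $\wedge_i$: from $\Gamma\vdash A$ and $\Gamma\vdash B$ infer $\Gamma\vdash C$ if $C\equiv A\wedge B$; $\wedge_e$: from $\Gamma\vdash C$ infer $\Gamma\vdash A$ (resp. $\Gamma\vdash B$) if $C\equiv A\wedge B$; $\vee_i$: from $\Gamma\vdash A$ (resp. $\Gamma\vdash B$) infer $\Gamma\vdash C$ if $C\equiv A\vee B$; $\vee_e$: from $\Gamma,A\vdash C$, $\Gamma,B\vdash C$ and $\Gamma\vdash D$ infer $\Gamma\vdash C$ if $D\equiv A\vee B$; $\top_i$: $\Gamma\vdash A$ if $A\equiv\top$; $\bot_e$: from $\Gamma\vdash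 B$ infer $\Gamma\vdash A$ if $B\equiv\bot$; $\forall_i$: from $\Gamma\vdash A$ infer $\Gamma\vdash B$ if $B\equiv\forall x\,A$ and $x$ is not free in $\Gamma$; $\forall_e$: from $\Gamma\vdash B$ infer $\Gamma\vdash C$ if $B\equiv\forall x\,A$ and $C\equiv(t/x)A$ for a term $t$; $\exists_i$: from $\Gamma\vdash C$ infer $\Gamma\vdash B$ if $B\equiv\exists x\,A$ and $C\equiv(t/x)A$; $\exists_e$: from $\Gamma\vdash C$ and $\Gamma,A\vdash B$ infer $\Gamma\vdash B$ if $C\equiv\exists x\,A$ and $x$ is not free in $\Gamma,B$. The rules with subscript $i$ are introduction rules, those with subscript $e$ elimination rules; in an elimination rule the major premise is the premise whose conclusion is congruent to the eliminated compound proposition ($\Gamma\vdash C$ in $\Rightarrow_e,\wedge_e,\exists_e$; $\Gamma\vdash D$ in $\vee_e$; $\Gamma\vdash B$ in $\bot_e,\forall_e$). A proof is neutral if its last rule is the axiom rule or an elimination rule. Cut-free proofs are defined inductively: a proof ending with the axiom rule is cut-free; a proof ending with an introduction rule whose premises are proved by cut-free proofs is cut-free; a proof ending with an elimination rule whose major premise is proved by a neutral cut-free proof and whose other premises are proved by cut-free proofs is cut-free. A truth values algebra is a structure $\langle B,B^+,\mathcal A,\mathcal E,\tilde\top,\tilde\bot,\tilde\Rightarrow,\tilde\wedge,\tilde\vee,\tilde\forall,\tilde\exists\rangle$ with $B^+\subseteq B$, $\mathcal A,\mathcal E\subseteq\wp(B)$, $\tilde\top,\tilde\bot\in B$, $\tilde\Rightarrow,\tilde\wedge,\tilde\vee:B\times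 B\to B$, $\tilde\forall:\mathcal A\to B$, $\tilde\exists:\mathcal E\to B$, such that for all $a,b,c\in B$, $A\in\mathcal A$, $E\in\mathcal E$ (with $\tilde\Rightarrow$ associating to the right): (1) if $a\tilde\Rightarrow b\in B^+$ and $a\in B^+$ then $b\in B^+$; (2) $a\tilde\Rightarrow b\tilde\Rightarrow a\in B^+$; (3) $(a\tilde\Rightarrow b\tilde\Rightarrow c)\tilde\Rightarrow(a\tilde\Rightarrow b)\tilde\Rightarrow a\tilde\Rightarrow c\in B^+$; (4) $\tilde\top\in B^+$; (5) $\tilde\bot\tilde\Rightarrow a\in B^+$; (6) $a\tilde\Rightarrow b\tilde\Rightarrow(a\tilde\wedge b)\in B^+$; (7) $(a\tilde\wedge b)\tilde\Rightarrow a\in B^+$; (8) $(a\tilde\wedge b)\tilde\Rightarrow b\in B^+$; (9) $a\tilde\Rightarrow(a\tilde\vee b)\in B^+$; (10) $b\tilde\Rightarrow(a\tilde\vee b)\in B^+$; (11) $(a\tilde\vee b)\tilde\Rightarrow(a\tilde\Rightarrow c)\tilde\Rightarrow(b\tilde\Rightarrow c)\tilde\Rightarrow c\in B^+$; (12) $\{a\tilde\Rightarrow e\mid e\in A\}\in\mathcal A$ and $\{e\tilde\Rightarrow a\mid e\in E\}\in\mathcal A$; (13) if $A\subseteq B^+$ then $\tilde\forall A\in B^+$; (14) $\tilde\forall\{a\tilde\Rightarrow e\mid e\in A\}\tilde\Rightarrow a\tilde\Rightarrow\tilde\forall A\in B^+$; (15) if $a\in A$ then $(\tilde\forall A)\tilde\Rightarrow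 a\in B^+$; (16) if $a\in E$ then $a\tilde\Rightarrow\tilde\exists E\in B^+$; (17) $(\tilde\exists E)\tilde\Rightarrow\tilde\forall\{e\tilde\Rightarrow a\mid e\in E\}\tilde\Rightarrow a\in B^+$. It is full if $\mathcal A=\mathcal E=\wp(B)$. It is ordered if equipped with a partial order $\sqsubseteq$ such that $B^+$ is upward closed, $\tilde\top$ and $\tilde\bot$ are maximal and minimal elements, $\tilde\wedge,\tilde\vee,\tilde\forall,\tilde\exists$ are monotone, and $\tilde\Rightarrow$ is antimonotone in its left and monotone in its right argument. An ordered one is complete if every subset of $B$ has a greatest lower bound. For such an algebra $\mathcal B$, a $\mathcal B$-valued model of $\equiv$ consists of a domain $M_s$ for each sort, functions $\hat f$ (into the domains) for function symbols and $\hat P$ (into $B$) for predicate symbols, such that the denotation ($[\![x]\!]_\phi=\phi(x)$, $[\![f(t_1,\dots,t_n)]\!]_\phi=\hat f([\![t_1]\!]_\phi,\dots)$, $[\![P(t_1,\dots,t_n)]\!]_\phi=\hat P(\dots)$, $[\![\top]\!]=\tilde\top$, $[\![\bot]\!]=\tilde\bot$, $[\![A\circ B]\!]_\phi=[\![A]\!]_\phi\tilde\circ[\![B]\!]_\phi$ for $\circ\in\{\Rightarrow,\wedge,\vee\}$, $[\![\forall x A]\!]_\phi=\tilde\forall\{[\![A]\!]_{\phi+(d/x)}\mid d\in M\}$, $[\![\exists xA]\!]_\phi=\tilde\exists\{[\![A]\!]_{\phi+(d/x)}\mid d\in M\}$, for assignments $\phi$ of variables to domain elements) is always defined and $[\![A]\!]_\phi=[\![B]\!]_\phi$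 whenever $A\equiv B$ (terms or propositions). The theory is super-consistent if it has a $\mathcal B$-valued model for every full, ordered and complete truth values algebra $\mathcal B$. *)

theory Defs
  imports Main "HOL-Library.Confluence"
begin

section \<open>Many-sorted first-order languages\<close>

text \<open>
  Propositions are taken up to renaming of bound variables, so binding is represented by de Bruijn
  indices. Every sort has its own countably infinite supply of variables and its own
  index space: \<open>Var s n\<close> is the \<open>n\<close>-th variable of sort \<open>s\<close>, and \<open>Forall s A\<close>, \<open>Exists s A\<close> bind the
  variable \<open>Var s 0\<close> of \<open>A\<close>, leaving the indices of the other sorts alone.
\<close>

datatype ('s, 'f) trm = Var 's nat | Fun 'f "('s, 'f) trm list"

datatype ('s, 'f, 'p) form =
    Atom 'p "('s, 'f) trm list"
  | Top
  | Bot
  | Imp "('s, 'f, 'p) form" "('s, 'f, 'p) form"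
  | And "('s, 'f, 'p) form" "('s, 'f, 'p) form"
  | Or "('s, 'f, 'p) form" "('s, 'f, 'p) form"
  | Forall 's "('s, 'f, 'p) form"
  | Exists 's "('s, 'f, 'p) form"

text \<open>The symbols of the language are those with a rank; hence a language may have no function
  symbols or no predicate symbols although types are inhabited.\<close>

record ('s, 'f, 'p) lang =
  fun_rank :: "'f \<Rightarrow> ('s list \<times> 's) option"
  pred_rank :: "'p \<Rightarrow> 's list option"

inductive has_sort :: "('s, 'f, 'p) lang \<Rightarrow> ('s, 'f) trm \<Rightarrow> 's \<Rightarrow> bool" for L where
  "has_sort L (Var s n) s"
| "fun_rank L f = Some (ss, s) \<Longrightarrow> list_all2 (has_sort L) ts ss \<Longrightarrow> has_sort L (Fun f ts) s"

definition wf_trm :: "('s, 'f, 'p) lang \<Rightarrow> ('s, 'f) trm \<Rightarrow> bool" where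
  "wf_trm L t \<longleftrightarrow> (\<exists>s. has_sort L t s)"

primrec wf_form :: "('s, 'f, 'p) lang \<Rightarrow> ('s, 'f, 'p) form \<Rightarrow> bool" where
  "wf_form L (Atom P ts) \<longleftrightarrow> (\<exists>ss. pred_rank L P = Some ss \<and> list_all2 (has_sort L) ts ss)"
| "wf_form L Top \<longleftrightarrow> True"
| "wf_form L Bot \<longleftrightarrow> True"
| "wf_form L (Imp A B) \<longleftrightarrow> wf_form L A \<and> wf_form L B"
| "wf_form L (And A B) \<longleftrightarrow> wf_form L A \<and> wf_form L B"
| "wf_form L (Or A B) \<longleftrightarrow> wf_form L A \<and> wf_form L B"
| "wf_form L (Forall s A) \<longleftrightarrow> wf_form L A"
| "wf_form L (Exists s A) \<longleftrightarrow> wf_form L A"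


section \<open>Substitution\<close>

type_synonym ('s, 'f) subst = "'s \<Rightarrow> nat \<Rightarrow> ('s, 'f) trm"

primrec subst_trm :: "('s, 'f) subst \<Rightarrow> ('s, 'f) trm \<Rightarrow> ('s, 'f) trm" where
  "subst_trm \<sigma> (Var s n) = \<sigma> s n"
| "subst_trm \<sigma> (Fun f ts) = Fun f (map (subst_trm \<sigma>) ts)"

definition shift :: "'s \<Rightarrow> ('s, 'f) subst" where
  "shift s = (\<lambda>s' n. Var s' (if s' = s then Suc n else n))"

text \<open>\<open>scons s x g\<close> maps the variable \<open>0\<close> of sort \<open>s\<close> to \<open>x\<close>, the variable \<open>n + 1\<close> of sort \<open>s\<close> to
  \<open>g s n\<close>, and agrees with \<open>g\<close> on the other sorts. It is used both for substitutions and for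
  assignments.\<close>

definition scons :: "'s \<Rightarrow> 'a \<Rightarrow> ('s \<Rightarrow> nat \<Rightarrow> 'a) \<Rightarrow> 's \<Rightarrow> nat \<Rightarrow> 'a" where
  "scons s x g = g(s := case_nat x (g s))"

definition push :: "'s \<Rightarrow> ('s, 'f) subst \<Rightarrow> ('s, 'f) subst" where
  "push s \<sigma> = scons s (Var s 0) (\<lambda>s' n. subst_trm (shift s) (\<sigma> s' n))"

primrec subst_form :: "('s, 'f) subst \<Rightarrow> ('s, 'f, 'p) form \<Rightarrow> ('s, 'f, 'p) form" where
  "subst_form \<sigma> (Atom P ts) = Atom P (map (subst_trm \<sigma>) ts)"
| "subst_form \<sigma> Top = Top"
| "subst_form \<sigma> Bot = Bot"
| "subst_form \<sigma> (Imp A B) = Imp (subst_form \<sigma> A) (subst_form \<sigma> B)"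
| "subst_form \<sigma> (And A B) = And (subst_form \<sigma> A) (subst_form \<sigma> B)"
| "subst_form \<sigma> (Or A B) = Or (subst_form \<sigma> A) (subst_form \<sigma> B)"
| "subst_form \<sigma> (Forall s A) = Forall s (subst_form (push s \<sigma>) A)"
| "subst_form \<sigma> (Exists s A) = Exists s (subst_form (push s \<sigma>) A)"

text \<open>\<open>inst s t A\<close> is \<open>(t/x)A\<close> for the body \<open>A\<close> of a quantifier over the sort \<open>s\<close>. A proposition
  of the form \<open>lift s A\<close> is one in which the variable \<open>Var s 0\<close> is not free.\<close>

definition inst :: "'s \<Rightarrow> ('s, 'f) trm \<Rightarrow> ('s, 'f, 'p) form \<Rightarrow> ('s, 'f, 'p) form" where
  "inst s t = subst_form (scons s t Var)"

definition lift :: "'s \<Rightarrow> ('s, 'f, 'p) form \<Rightarrow> ('s, 'f, 'p) form" where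
  "lift s = subst_form (shift s)"

definition wf_subst :: "('s, 'f, 'p) lang \<Rightarrow> ('s, 'f) subst \<Rightarrow> bool" where
  "wf_subst L \<sigma> \<longleftrightarrow> (\<forall>s n. has_sort L (\<sigma> s n) s)"


section \<open>Rewrite systems and the congruence they define\<close>

text \<open>A proposition rule \<open>((P, ts), A)\<close> rewrites the atomic proposition \<open>Atom P ts\<close> to \<open>A\<close>.\<close>

record ('s, 'f, 'p) rewrite_system =
  trm_rules :: "(('s, 'f) trm \<times> ('s, 'f) trm) set"
  prop_rules :: "(('p \<times> ('s, 'f) trm list) \<times> ('s, 'f, 'p) form) set"

definition wf_rewrite_system ::
  "('s, 'f, 'p) lang \<Rightarrow> ('s, 'f, 'p) rewrite_system \<Rightarrow> bool" where
  "wf_rewrite_system L R \<longleftrightarrow>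
     (\<forall>(l, r) \<in> trm_rules R. \<exists>s. has_sort L l s \<and> has_sort L r s) \<and>
     (\<forall>((P, ts), A) \<in> prop_rules R. wf_form L (Atom P ts) \<and> wf_form L A)"

inductive trm_step ::
  "('s, 'f, 'p) lang \<Rightarrow> ('s, 'f, 'p) rewrite_system \<Rightarrow> ('s, 'f) trm \<Rightarrow> ('s, 'f) trm \<Rightarrow> bool"
  for L R where
  "(l, r) \<in> trm_rules R \<Longrightarrow> wf_subst L \<sigma> \<Longrightarrow> trm_step L R (subst_trm \<sigma> l) (subst_trm \<sigma> r)"
| "trm_step L R t u \<Longrightarrow> trm_step L R (Fun f (ts @ t # us)) (Fun f (ts @ u # us))"

inductive form_step ::
  "('s, 'f, 'p) lang \<Rightarrow> ('s, 'f, 'p) rewrite_system \<Rightarrow>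
   ('s, 'f, 'p) form \<Rightarrow> ('s, 'f, 'p) form \<Rightarrow> bool"
  for L R where
  "((P, ts), A) \<in> prop_rules R \<Longrightarrow> wf_subst L \<sigma> \<Longrightarrow>
     form_step L R (subst_form \<sigma> (Atom P ts)) (subst_form \<sigma> A)"
| "trm_step L R t u \<Longrightarrow> form_step L R (Atom P (ts @ t # us)) (Atom P (ts @ u # us))"
| "form_step L R A A' \<Longrightarrow> form_step L R (Imp A B) (Imp A' B)"
| "form_step L R B B' \<Longrightarrow> form_step L R (Imp A B) (Imp A B')"
| "form_step L R A A' \<Longrightarrow> form_step L R (And A B) (And A' B)"
| "form_step L R B B' \<Longrightarrow> form_step L R (And A B) (And A B')"
| "form_step L R A A' \<Longrightarrow> form_step L R (Or A B) (Or A' B)"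
| "form_step L R B B' \<Longrightarrow> form_step L R (Or A B) (Or A B')"
| "form_step L R A A' \<Longrightarrow> form_step L R (Forall s A) (Forall s A')"
| "form_step L R A A' \<Longrightarrow> form_step L R (Exists s A) (Exists s A')"

definition trm_rew ::
  "('s, 'f, 'p) lang \<Rightarrow> ('s, 'f, 'p) rewrite_system \<Rightarrow> ('s, 'f) trm \<Rightarrow> ('s, 'f) trm \<Rightarrow> bool" where
  "trm_rew L R t u \<longleftrightarrow> wf_trm L t \<and> wf_trm L u \<and> trm_step L R t u"

definition form_rew ::
  "('s, 'f, 'p) lang \<Rightarrow> ('s, 'f, 'p) rewrite_system \<Rightarrow>
   ('s, 'f, 'p) form \<Rightarrow> ('s, 'f, 'p) form \<Rightarrow> bool" where
  "form_rew L R A B \<longleftrightarrow> wf_form L A \<and> wf_form L B \<and> form_step L R A B"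

definition confluent :: "('s, 'f, 'p) lang \<Rightarrow> ('s, 'f, 'p) rewrite_system \<Rightarrow> bool" where
  "confluent L R \<longleftrightarrow> confluentp (trm_rew L R) \<and> confluentp (form_rew L R)"

definition trm_cong ::
  "('s, 'f, 'p) lang \<Rightarrow> ('s, 'f, 'p) rewrite_system \<Rightarrow> ('s, 'f) trm \<Rightarrow> ('s, 'f) trm \<Rightarrow> bool" where
  "trm_cong L R t u \<longleftrightarrow> wf_trm L t \<and> wf_trm L u \<and> equivclp (trm_rew L R) t u"

definition form_cong ::
  "('s, 'f, 'p) lang \<Rightarrow> ('s, 'f, 'p) rewrite_system \<Rightarrow>
   ('s, 'f, 'p) form \<Rightarrow> ('s, 'f, 'p) form \<Rightarrow> bool" where
  "form_cong L R A B \<longleftrightarrow> wf_form L A \<and> wf_form L B \<and> equivclp (form_rew L R) A B"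


section \<open>Natural deduction modulo\<close>

type_synonym ('s, 'f, 'p) sequent = "('s, 'f, 'p) form list \<times> ('s, 'f, 'p) form"

text \<open>Neutrality and cut-freeness only depend on the rules applied in a proof, so a proof is
  represented by its tree of rule names. The major premise of an elimination rule comes first.\<close>

datatype nd_proof =
    Axiom
  | ImpI nd_proof
  | ImpE nd_proof nd_proof
  | AndI nd_proof nd_proof
  | AndE1 nd_proof
  | AndE2 nd_proof
  | OrI1 nd_proof
  | OrI2 nd_proof
  | OrE nd_proof nd_proof nd_proof
  | TopI
  | BotE nd_proof
  | AllI nd_proof
  | AllE nd_proof
  | ExI nd_proof
  | ExE nd_proof nd_proof

text \<open>\<open>proves L R \<pi> \<Gamma> B\<close>: \<open>\<pi>\<close> is a proof of the sequent \<open>\<Gamma> \<turnstile> B\<close>. The context \<open>\<Gamma>, A\<close> is \<open>A # \<Gamma>\<close>.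
  In the rules \<open>AllI\<close> and \<open>ExE\<close>, passing from \<open>\<Gamma>\<close> to \<open>map (lift s) \<Gamma>\<close> renders the condition that
  the bound variable is not free in \<open>\<Gamma>\<close>.\<close>

inductive proves ::
  "('s, 'f, 'p) lang \<Rightarrow> ('s, 'f, 'p) rewrite_system \<Rightarrow> nd_proof \<Rightarrow>
   ('s, 'f, 'p) form list \<Rightarrow> ('s, 'f, 'p) form \<Rightarrow> bool"
  for L R where
  "\<forall>D \<in> set \<Gamma>. wf_form L D \<Longrightarrow> A \<in> set \<Gamma> \<Longrightarrow> form_cong L R B A \<Longrightarrow> proves L R Axiom \<Gamma> B"
| "proves L R \<pi> (A # \<Gamma>) B \<Longrightarrow> form_cong L R C (Imp A B) \<Longrightarrow> proves L R (ImpI \<pi>) \<Gamma> C"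
| "proves L R \<pi> \<Gamma> C \<Longrightarrow> proves L R \<rho> \<Gamma> A \<Longrightarrow> form_cong L R C (Imp A B) \<Longrightarrow>
     proves L R (ImpE \<pi> \<rho>) \<Gamma> B"
| "proves L R \<pi> \<Gamma> A \<Longrightarrow> proves L R \<rho> \<Gamma> B \<Longrightarrow> form_cong L R C (And A B) \<Longrightarrow>
     proves L R (AndI \<pi> \<rho>) \<Gamma> C"
| "proves L R \<pi> \<Gamma> C \<Longrightarrow> form_cong L R C (And A B) \<Longrightarrow> proves L R (AndE1 \<pi>) \<Gamma> A"
| "proves L R \<pi> \<Gamma> C \<Longrightarrow> form_cong L R C (And A B) \<Longrightarrow> proves L R (AndE2 \<pi>) \<Gamma> B"
| "proves L R \<pi> \<Gamma> A \<Longrightarrow> form_cong L R C (Or A B) \<Longrightarrow> proves L R (OrI1 \<pi>) \<Gamma> C"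
| "proves L R \<pi> \<Gamma> B \<Longrightarrow> form_cong L R C (Or A B) \<Longrightarrow> proves L R (OrI2 \<pi>) \<Gamma> C"
| "proves L R \<pi> \<Gamma> D \<Longrightarrow> proves L R \<rho> (A # \<Gamma>) C \<Longrightarrow> proves L R \<tau> (B # \<Gamma>) C \<Longrightarrow>
     form_cong L R D (Or A B) \<Longrightarrow> proves L R (OrE \<pi> \<rho> \<tau>) \<Gamma> C"
| "\<forall>D \<in> set \<Gamma>. wf_form L D \<Longrightarrow> form_cong L R A Top \<Longrightarrow> proves L R TopI \<Gamma> A"
| "proves L R \<pi> \<Gamma> B \<Longrightarrow> form_cong L R B Bot \<Longrightarrow> wf_form L A \<Longrightarrow> proves L R (BotE \<pi>) \<Gamma> A"
| "proves L R \<pi> (map (lift s) \<Gamma>) A \<Longrightarrow> form_cong L R B (Forall s A) \<Longrightarrow> proves L R (AllI \<pi>) \<Gamma> B"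
| "proves L R \<pi> \<Gamma> B \<Longrightarrow> form_cong L R B (Forall s A) \<Longrightarrow> has_sort L t s \<Longrightarrow>
     form_cong L R C (inst s t A) \<Longrightarrow> proves L R (AllE \<pi>) \<Gamma> C"
| "proves L R \<pi> \<Gamma> C \<Longrightarrow> form_cong L R B (Exists s A) \<Longrightarrow> has_sort L t s \<Longrightarrow>
     form_cong L R C (inst s t A) \<Longrightarrow> proves L R (ExI \<pi>) \<Gamma> B"
| "proves L R \<pi> \<Gamma> C \<Longrightarrow> proves L R \<rho> (A # map (lift s) \<Gamma>) (lift s B) \<Longrightarrow>
     form_cong L R C (Exists s A) \<Longrightarrow> proves L R (ExE \<pi> \<rho>) \<Gamma> B"

fun neutral :: "nd_proof \<Rightarrow> bool" where
  "neutral Axiom = True"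
| "neutral (ImpE _ _) = True"
| "neutral (AndE1 _) = True"
| "neutral (AndE2 _) = True"
| "neutral (OrE _ _ _) = True"
| "neutral (BotE _) = True"
| "neutral (AllE _) = True"
| "neutral (ExE _ _) = True"
| "neutral _ = False"

inductive cut_free :: "nd_proof \<Rightarrow> bool" where
  "cut_free Axiom"
| "cut_free \<pi> \<Longrightarrow> cut_free (ImpI \<pi>)"
| "cut_free \<pi> \<Longrightarrow> cut_free \<rho> \<Longrightarrow> cut_free (AndI \<pi> \<rho>)"
| "cut_free \<pi> \<Longrightarrow> cut_free (OrI1 \<pi>)"
| "cut_free \<pi> \<Longrightarrow> cut_free (OrI2 \<pi>)"
| "cut_free TopI"
| "cut_free \<pi> \<Longrightarrow> cut_free (AllI \<pi>)"
| "cut_free \<pi> \<Longrightarrow> cut_free (ExI \<pi>)"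
| "neutral \<pi> \<Longrightarrow> cut_free \<pi> \<Longrightarrow> cut_free \<rho> \<Longrightarrow> cut_free (ImpE \<pi> \<rho>)"
| "neutral \<pi> \<Longrightarrow> cut_free \<pi> \<Longrightarrow> cut_free (AndE1 \<pi>)"
| "neutral \<pi> \<Longrightarrow> cut_free \<pi> \<Longrightarrow> cut_free (AndE2 \<pi>)"
| "neutral \<pi> \<Longrightarrow> cut_free \<pi> \<Longrightarrow> cut_free \<rho> \<Longrightarrow> cut_free \<tau> \<Longrightarrow> cut_free (OrE \<pi> \<rho> \<tau>)"
| "neutral \<pi> \<Longrightarrow> cut_free \<pi> \<Longrightarrow> cut_free (BotE \<pi>)"
| "neutral \<pi> \<Longrightarrow> cut_free \<pi> \<Longrightarrow> cut_free (AllE \<pi>)"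
| "neutral \<pi> \<Longrightarrow> cut_free \<pi> \<Longrightarrow> cut_free \<rho> \<Longrightarrow> cut_free (ExE \<pi> \<rho>)"


section \<open>Truth values algebras\<close>

record 'b tva =
  carrier :: "'b set"
  positive :: "'b set"
  all_dom :: "'b set set"
  ex_dom :: "'b set set"
  ttop :: 'b
  tbot :: 'b
  timp :: "'b \<Rightarrow> 'b \<Rightarrow> 'b" (infixr "\<rightarrow>\<index>" 60)
  tand :: "'b \<Rightarrow> 'b \<Rightarrow> 'b"
  tor :: "'b \<Rightarrow> 'b \<Rightarrow> 'b"
  tall :: "'b set \<Rightarrow> 'b"
  tex :: "'b set \<Rightarrow> 'b"

locale truth_values_algebra =
  fixes V :: "'b tva" (structure)
  assumes positive_subset: "positive V \<subseteq> carrier V"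
    and all_dom_subset: "all_dom V \<subseteq> Pow (carrier V)"
    and ex_dom_subset: "ex_dom V \<subseteq> Pow (carrier V)"
    and top_closed: "ttop V \<in> carrier V"
    and bot_closed: "tbot V \<in> carrier V"
    and imp_closed: "\<lbrakk>a \<in> carrier V; b \<in> carrier V\<rbrakk> \<Longrightarrow> a \<rightarrow> b \<in> carrier V"
    and and_closed: "\<lbrakk>a \<in> carrier V; b \<in> carrier V\<rbrakk> \<Longrightarrow> tand V a b \<in> carrier V"
    and or_closed: "\<lbrakk>a \<in> carrier V; b \<in> carrier V\<rbrakk> \<Longrightarrow> tor V a b \<in> carrier V"
    and all_closed: "A \<in> all_dom V \<Longrightarrow> tall V A \<in> carrier V"
    and ex_closed: "E \<in> ex_dom V \<Longrightarrow> tex V E \<in> carrier V"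
    and mp: "\<lbrakk>a \<in> carrier V; b \<in> carrier V; a \<rightarrow> b \<in> positive V; a \<in> positive V\<rbrakk>
        \<Longrightarrow> b \<in> positive V"
    and ax_K: "\<lbrakk>a \<in> carrier V; b \<in> carrier V\<rbrakk> \<Longrightarrow> a \<rightarrow> b \<rightarrow> a \<in> positive V"
    and ax_S: "\<lbrakk>a \<in> carrier V; b \<in> carrier V; c \<in> carrier V\<rbrakk>
        \<Longrightarrow> (a \<rightarrow> b \<rightarrow> c) \<rightarrow> (a \<rightarrow> b) \<rightarrow> a \<rightarrow> c \<in> positive V"
    and ax_top: "ttop V \<in> positive V"
    and ax_bot: "a \<in> carrier V \<Longrightarrow> tbot V \<rightarrow> a \<in> positive V"
    and ax_and: "\<lbrakk>a \<in> carrier V; b \<in> carrier V\<rbrakk> \<Longrightarrow> a \<rightarrow> b \<rightarrow> tand V a b \<in> positive V"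
    and ax_and1: "\<lbrakk>a \<in> carrier V; b \<in> carrier V\<rbrakk> \<Longrightarrow> tand V a b \<rightarrow> a \<in> positive V"
    and ax_and2: "\<lbrakk>a \<in> carrier V; b \<in> carrier V\<rbrakk> \<Longrightarrow> tand V a b \<rightarrow> b \<in> positive V"
    and ax_or1: "\<lbrakk>a \<in> carrier V; b \<in> carrier V\<rbrakk> \<Longrightarrow> a \<rightarrow> tor V a b \<in> positive V"
    and ax_or2: "\<lbrakk>a \<in> carrier V; b \<in> carrier V\<rbrakk> \<Longrightarrow> b \<rightarrow> tor V a b \<in> positive V"
    and ax_or: "\<lbrakk>a \<in> carrier V; b \<in> carrier V; c \<in> carrier V\<rbrakk>
        \<Longrightarrow> tor V a b \<rightarrow> (a \<rightarrow> c) \<rightarrow> (b \<rightarrow> c) \<rightarrow> c \<in> positive V"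
    and imp_all_dom: "\<lbrakk>a \<in> carrier V; A \<in> all_dom V\<rbrakk> \<Longrightarrow> {a \<rightarrow> e | e. e \<in> A} \<in> all_dom V"
    and imp_ex_dom: "\<lbrakk>a \<in> carrier V; E \<in> ex_dom V\<rbrakk> \<Longrightarrow> {e \<rightarrow> a | e. e \<in> E} \<in> all_dom V"
    and ax_gen: "\<lbrakk>A \<in> all_dom V; A \<subseteq> positive V\<rbrakk> \<Longrightarrow> tall V A \<in> positive V"
    and ax_all_imp: "\<lbrakk>a \<in> carrier V; A \<in> all_dom V\<rbrakk>
        \<Longrightarrow> tall V {a \<rightarrow> e | e. e \<in> A} \<rightarrow> a \<rightarrow> tall V A \<in> positive V"
    and ax_all: "\<lbrakk>A \<in> all_dom V; a \<in> A\<rbrakk> \<Longrightarrow> tall V A \<rightarrow> a \<in> positive V"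
    and ax_ex: "\<lbrakk>E \<in> ex_dom V; a \<in> E\<rbrakk> \<Longrightarrow> a \<rightarrow> tex V E \<in> positive V"
    and ax_ex_imp: "\<lbrakk>a \<in> carrier V; E \<in> ex_dom V\<rbrakk>
        \<Longrightarrow> tex V E \<rightarrow> tall V {e \<rightarrow> a | e. e \<in> E} \<rightarrow> a \<in> positive V"

definition full_tva :: "'b tva \<Rightarrow> bool" where
  "full_tva V \<longleftrightarrow> all_dom V = Pow (carrier V) \<and> ex_dom V = Pow (carrier V)"

text \<open>Monotonicity of \<open>tall\<close> and \<open>tex\<close> refers to the pointwise order on families of truth values:
  \<open>rel_set le A A'\<close> holds iff \<open>A\<close> and \<open>A'\<close> are the ranges of families \<open>f\<close>, \<open>g\<close> over a common index
  set with \<open>le (f i) (g i)\<close> for every index \<open>i\<close>.\<close>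

locale ordered_tva = truth_values_algebra V for V :: "'b tva" (structure) +
  fixes le :: "'b \<Rightarrow> 'b \<Rightarrow> bool"
  assumes le_refl: "reflp_on (carrier V) le"
    and le_antisym: "antisymp_on (carrier V) le"
    and le_trans: "transp_on (carrier V) le"
    and positive_upward: "\<lbrakk>a \<in> positive V; b \<in> carrier V; le a b\<rbrakk> \<Longrightarrow> b \<in> positive V"
    and top_maximal: "\<lbrakk>a \<in> carrier V; le (ttop V) a\<rbrakk> \<Longrightarrow> a = ttop V"
    and bot_minimal: "\<lbrakk>a \<in> carrier V; le a (tbot V)\<rbrakk> \<Longrightarrow> a = tbot V"
    and and_mono: "\<lbrakk>a \<in> carrier V; a' \<in> carrier V; b \<in> carrier V; b' \<in> carrier V; le a a'; le b b'\<rbrakk>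
        \<Longrightarrow> le (tand V a b) (tand V a' b')"
    and or_mono: "\<lbrakk>a \<in> carrier V; a' \<in> carrier V; b \<in> carrier V; b' \<in> carrier V; le a a'; le b b'\<rbrakk>
        \<Longrightarrow> le (tor V a b) (tor V a' b')"
    and all_mono: "\<lbrakk>A \<in> all_dom V; A' \<in> all_dom V; rel_set le A A'\<rbrakk> \<Longrightarrow> le (tall V A) (tall V A')"
    and ex_mono: "\<lbrakk>E \<in> ex_dom V; E' \<in> ex_dom V; rel_set le E E'\<rbrakk> \<Longrightarrow> le (tex V E) (tex V E')"
    and imp_mono: "\<lbrakk>a \<in> carrier V; a' \<in> carrier V; b \<in> carrier V; b' \<in> carrier V; le a' a; le b b'\<rbrakk>
        \<Longrightarrow> le (a \<rightarrow> b) (a' \<rightarrow> b')"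

definition complete_tva :: "'b tva \<Rightarrow> ('b \<Rightarrow> 'b \<Rightarrow> bool) \<Rightarrow> bool" where
  "complete_tva V le \<longleftrightarrow>
     (\<forall>X \<subseteq> carrier V. \<exists>g \<in> carrier V. (\<forall>x \<in> X. le g x) \<and>
        (\<forall>h \<in> carrier V. (\<forall>x \<in> X. le h x) \<longrightarrow> le h g))"


section \<open>Models and super-consistency\<close>

record ('s, 'f, 'p, 'm, 'b) fo_structure =
  domain_of :: "'s \<Rightarrow> 'm set"
  fun_int :: "'f \<Rightarrow> 'm list \<Rightarrow> 'm"
  pred_int :: "'p \<Rightarrow> 'm list \<Rightarrow> 'b"

text \<open>Domains are non-empty, as usual for first-order structures: with an empty domain there would
  be no assignments at all and every congruence would have a model.\<close>

definition wf_structure ::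
  "('s, 'f, 'p) lang \<Rightarrow> 'b tva \<Rightarrow> ('s, 'f, 'p, 'm, 'b) fo_structure \<Rightarrow> bool" where
  "wf_structure L V M \<longleftrightarrow>
     (\<forall>s. domain_of M s \<noteq> {}) \<and>
     (\<forall>f ss s xs. fun_rank L f = Some (ss, s) \<longrightarrow> list_all2 (\<lambda>x s. x \<in> domain_of M s) xs ss \<longrightarrow>
        fun_int M f xs \<in> domain_of M s) \<and>
     (\<forall>P ss xs. pred_rank L P = Some ss \<longrightarrow> list_all2 (\<lambda>x s. x \<in> domain_of M s) xs ss \<longrightarrow>
        pred_int M P xs \<in> carrier V)"

definition assignment :: "('s, 'f, 'p, 'm, 'b) fo_structure \<Rightarrow> ('s \<Rightarrow> nat \<Rightarrow> 'm) \<Rightarrow> bool" where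
  "assignment M \<phi> \<longleftrightarrow> (\<forall>s n. \<phi> s n \<in> domain_of M s)"

primrec den_trm ::
  "('s, 'f, 'p, 'm, 'b) fo_structure \<Rightarrow> ('s \<Rightarrow> nat \<Rightarrow> 'm) \<Rightarrow> ('s, 'f) trm \<Rightarrow> 'm" where
  "den_trm M \<phi> (Var s n) = \<phi> s n"
| "den_trm M \<phi> (Fun f ts) = fun_int M f (map (den_trm M \<phi>) ts)"

primrec den ::
  "'b tva \<Rightarrow> ('s, 'f, 'p, 'm, 'b) fo_structure \<Rightarrow> ('s \<Rightarrow> nat \<Rightarrow> 'm) \<Rightarrow> ('s, 'f, 'p) form \<Rightarrow> 'b" where
  "den V M \<phi> (Atom P ts) = pred_int M P (map (den_trm M \<phi>) ts)"
| "den V M \<phi> Top = ttop V"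
| "den V M \<phi> Bot = tbot V"
| "den V M \<phi> (Imp A B) = timp V (den V M \<phi> A) (den V M \<phi> B)"
| "den V M \<phi> (And A B) = tand V (den V M \<phi> A) (den V M \<phi> B)"
| "den V M \<phi> (Or A B) = tor V (den V M \<phi> A) (den V M \<phi> B)"
| "den V M \<phi> (Forall s A) = tall V {den V M (scons s d \<phi>) A | d. d \<in> domain_of M s}"
| "den V M \<phi> (Exists s A) = tex V {den V M (scons s d \<phi>) A | d. d \<in> domain_of M s}"

primrec den_defined ::
  "'b tva \<Rightarrow> ('s, 'f, 'p, 'm, 'b) fo_structure \<Rightarrow> ('s \<Rightarrow> nat \<Rightarrow> 'm) \<Rightarrow> ('s, 'f, 'p) form \<Rightarrow> bool" where
  "den_defined V M \<phi> (Atom P ts) \<longleftrightarrow> True"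
| "den_defined V M \<phi> Top \<longleftrightarrow> True"
| "den_defined V M \<phi> Bot \<longleftrightarrow> True"
| "den_defined V M \<phi> (Imp A B) \<longleftrightarrow> den_defined V M \<phi> A \<and> den_defined V M \<phi> B"
| "den_defined V M \<phi> (And A B) \<longleftrightarrow> den_defined V M \<phi> A \<and> den_defined V M \<phi> B"
| "den_defined V M \<phi> (Or A B) \<longleftrightarrow> den_defined V M \<phi> A \<and> den_defined V M \<phi> B"
| "den_defined V M \<phi> (Forall s A) \<longleftrightarrow> (\<forall>d \<in> domain_of M s. den_defined V M (scons s d \<phi>) A) \<and>
     {den V M (scons s d \<phi>) A | d. d \<in> domain_of M s} \<in> all_dom V"
| "den_defined V M \<phi> (Exists s A) \<longleftrightarrow> (\<forall>d \<in> domain_of M s. den_defined V M (scons s d \<phi>) A) \<and>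
     {den V M (scons s d \<phi>) A | d. d \<in> domain_of M s} \<in> ex_dom V"

definition is_model ::
  "('s, 'f, 'p) lang \<Rightarrow> ('s, 'f, 'p) rewrite_system \<Rightarrow> 'b tva \<Rightarrow>
   ('s, 'f, 'p, 'm, 'b) fo_structure \<Rightarrow> bool" where
  "is_model L R V M \<longleftrightarrow> wf_structure L V M \<and>
     (\<forall>\<phi>. assignment M \<phi> \<longrightarrow>
        (\<forall>A. wf_form L A \<longrightarrow> den_defined V M \<phi> A) \<and>
        (\<forall>t u. trm_cong L R t u \<longrightarrow> den_trm M \<phi> t = den_trm M \<phi> u) \<and>
        (\<forall>A B. form_cong L R A B \<longrightarrow> den V M \<phi> A = den V M \<phi> B))"

text \<open>A formula cannot quantify over types, so super-consistency is relative to a type \<open>'b\<close> in which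
  the carriers of the algebras live and a type \<open>'m\<close> in which the domains of the models live. Assuming
  it for one \<open>'b\<close> is weaker than assuming it for all algebras; a type variable \<open>'m\<close> in a theorem
  assuming it leaves the domains arbitrary.\<close>

definition super_consistent ::
  "'b itself \<Rightarrow> 'm itself \<Rightarrow> ('s, 'f, 'p) lang \<Rightarrow> ('s, 'f, 'p) rewrite_system \<Rightarrow> bool" where
  "super_consistent _ _ L R \<longleftrightarrow>
     (\<forall>(V :: 'b tva) le. ordered_tva V le \<and> full_tva V \<and> complete_tva V le \<longrightarrow>
        (\<exists>M :: ('s, 'f, 'p, 'm, 'b) fo_structure. is_model L R V M))"

end

theory Submission
  imports Defs
begin

text \<open>
  Call a set of sequents a candidate if it contains all sequents with a neutral cut-free proof, only
  contains sequents with a cut-free proof, and is closed under substitution, weakening and the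
  congruence. The candidates form a full, ordered and complete truth values algebra, so
  super-consistency provides a model valued in it. By induction on proofs, if \<open>\<Gamma> \<turnstile> B\<close> is provable and
  \<open>\<Delta> \<turnstile> \<sigma>A\<close> belongs to \<open>\<lbrakk>A\<rbrakk>\<phi>\<close> for all \<open>A\<close> in \<open>\<Gamma>\<close>, then \<open>\<Delta> \<turnstile> \<sigma>B\<close> belongs to \<open>\<lbrakk>B\<rbrakk>\<phi>\<close>; here the
  substitution \<open>\<sigma>\<close> and the assignment \<open>\<phi>\<close> are unrelated, so no term model is needed. Confluence
  enters when a non-neutral sequent is eliminated: congruent compound propositions have congruent
  components. Taking \<open>\<Delta> = \<Gamma>\<close> and \<open>\<sigma>\<close> the identity yields a cut-free proof.
\<close>


section \<open>Substitution\<close>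

definition comp_subst :: "('s, 'f) subst \<Rightarrow> ('s, 'f) subst \<Rightarrow> ('s, 'f) subst" where
  "comp_subst \<eta> \<theta> = (\<lambda>s n. subst_trm \<eta> (\<theta> s n))"

lemma subst_trm_subst_trm: "subst_trm \<eta> (subst_trm \<theta> t) = subst_trm (comp_subst \<eta> \<theta>) t"
  by (induction t) (auto simp: comp_subst_def)

lemma subst_trm_Var [simp]: "subst_trm Var t = t"
  by (induction t) (auto simp: map_idI)

lemma comp_subst_assoc: "comp_subst (comp_subst \<eta> \<theta>) \<sigma> = comp_subst \<eta> (comp_subst \<theta> \<sigma>)"
  by (simp add: comp_subst_def subst_trm_subst_trm)

lemma comp_subst_Var [simp]: "comp_subst \<eta> Var = \<eta>" "comp_subst Var \<eta> = \<eta>"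
  by (auto simp: comp_subst_def)

lemma comp_subst_scons: "comp_subst \<eta> (scons s t \<theta>) = scons s (subst_trm \<eta> t) (comp_subst \<eta> \<theta>)"
  by (auto simp: comp_subst_def scons_def fun_eq_iff split: nat.split)

lemma comp_subst_scons_shift [simp]: "comp_subst (scons s t \<theta>) (shift s) = \<theta>"
  by (auto simp: comp_subst_def scons_def shift_def fun_eq_iff)

lemma scons_Var_shift [simp]: "scons s (Var s 0) (shift s) = Var"
  by (auto simp: scons_def shift_def fun_eq_iff split: nat.split)

lemma push_eq: "push s \<theta> = scons s (Var s 0) (comp_subst (shift s) \<theta>)"
  by (simp add: push_def comp_subst_def)

lemma push_Var [simp]: "push s Var = Var"
  by (simp add: push_eq)

text \<open>The law behind every quantifier argument: it fuses a substitution that went under a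
  binder with the later choice of a term for the bound variable.\<close>

lemma comp_subst_scons_push: "comp_subst (scons s t \<theta>) (push s \<sigma>) = scons s t (comp_subst \<theta> \<sigma>)"
  by (simp add: push_eq comp_subst_scons comp_subst_assoc[symmetric]) (simp add: scons_def)

lemma comp_subst_push: "comp_subst (push s \<eta>) (push s \<theta>) = push s (comp_subst \<eta> \<theta>)"
  by (simp add: push_eq[of s \<eta>] comp_subst_scons_push comp_subst_assoc) (simp add: push_eq)

lemma comp_subst_push_shift: "comp_subst (push s \<theta>) (shift s) = comp_subst (shift s) \<theta>"
  by (simp add: push_eq)

lemma subst_form_subst_form: "subst_form \<eta> (subst_form \<theta> A) = subst_form (comp_subst \<eta> \<theta>) A"
  by (induction A arbitrary: \<eta> \<theta>) (auto simp: subst_trm_subst_trm comp_subst_push)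

lemma subst_form_Var [simp]: "subst_form Var A = A"
  by (induction A) (auto simp: map_idI)

text \<open>Used for contexts of the form \<open>map (lift s) \<Gamma>\<close>: no choice of a term
  for the eigenvariable affects them.\<close>

lemma subst_form_lift:
  "subst_form (scons s t \<theta>) (lift s A) = subst_form \<theta> A"
  "subst_form (push s \<theta>) (lift s A) = lift s (subst_form \<theta> A)"
  by (simp_all add: lift_def subst_form_subst_form comp_subst_push_shift)

lemma subst_form_inst:
  "subst_form \<theta> (inst s t A) = subst_form (scons s (subst_trm \<theta> t) \<theta>) A"
  by (simp add: inst_def subst_form_subst_form comp_subst_scons)

lemma inst_subst_form_push: "inst s t (subst_form (push s \<theta>) A) = subst_form (scons s t \<theta>) A"
  by (simp add: inst_def subst_form_subst_form comp_subst_scons_push)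

section \<open>Sorts and well-formedness under substitution\<close>

lemma has_sort_subst_trm:
  assumes "has_sort L t s" "wf_subst L \<theta>"
  shows "has_sort L (subst_trm \<theta> t) s"
  using assms(1)
proof (induction rule: has_sort.induct)
  case (1 s n)
  then show ?case using assms(2) by (simp add: wf_subst_def)
next
  case (2 f ss s ts)
  then have "list_all2 (has_sort L) (map (subst_trm \<theta>) ts) ss"
    by (auto simp: list_all2_conv_all_nth)
  then show ?case using 2 by (auto intro: has_sort.intros)
qed

lemma wf_subst_Var: "wf_subst L Var"
  by (simp add: wf_subst_def has_sort.intros)

lemma wf_subst_shift: "wf_subst L (shift s)"
  by (simp add: wf_subst_def shift_def has_sort.intros)

lemma wf_subst_scons: "has_sort L t s \<Longrightarrow> wf_subst L \<theta> \<Longrightarrow> wf_subst L (scons s t \<theta>)"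
  by (auto simp: wf_subst_def scons_def split: nat.split)

lemma wf_subst_comp_subst: "wf_subst L \<eta> \<Longrightarrow> wf_subst L \<theta> \<Longrightarrow> wf_subst L (comp_subst \<eta> \<theta>)"
  by (simp add: wf_subst_def comp_subst_def has_sort_subst_trm)

lemma wf_subst_push: "wf_subst L \<theta> \<Longrightarrow> wf_subst L (push s \<theta>)"
  by (simp add: push_eq wf_subst_scons wf_subst_comp_subst wf_subst_shift has_sort.intros)

lemma wf_form_subst_form: "wf_form L A \<Longrightarrow> wf_subst L \<theta> \<Longrightarrow> wf_form L (subst_form \<theta> A)"
proof (induction A arbitrary: \<theta>)
  case (Atom P ts)
  then show ?case by (auto simp: list_all2_conv_all_nth has_sort_subst_trm)
qed (auto simp: wf_subst_push)

lemma wf_form_lift_iff [simp]: "wf_form L (lift s A) \<longleftrightarrow> wf_form L A"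
proof
  assume "wf_form L (lift s A)"
  \<comment> \<open>Instantiating the lifted-over variable by a well-sorted term undoes the lift. A
    variable serves, as every sort has some.\<close>
  then have "wf_form L (subst_form (scons s (Var s 0) Var) (lift s A))"
    by (intro wf_form_subst_form wf_subst_scons wf_subst_Var has_sort.intros)
  then show "wf_form L A" by (simp add: subst_form_lift)
qed (simp add: lift_def wf_form_subst_form wf_subst_shift)


section \<open>The congruence\<close>

lemma trm_step_subst_trm:
  assumes "trm_step L R t u" "wf_subst L \<theta>"
  shows "trm_step L R (subst_trm \<theta> t) (subst_trm \<theta> u)"
  using assms(1)
proof (induction rule: trm_step.induct)
  case (1 l r \<sigma>)
  then show ?case
    using assms(2) by (auto simp: subst_trm_subst_trm wf_subst_comp_subst intro: trm_step.intros)
qed (auto intro: trm_step.intros)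

lemma form_step_subst_form:
  assumes "form_step L R A B" "wf_subst L \<theta>"
  shows "form_step L R (subst_form \<theta> A) (subst_form \<theta> B)"
  using assms
proof (induction arbitrary: \<theta> rule: form_step.induct)
  case (1 P ts A \<sigma>)
  then show ?case
    \<comment> \<open>A substituted rule instance is the instance of the same rule under the
      composed substitution.\<close>
    using form_step.intros(1)[of P ts A R L "comp_subst \<theta> \<sigma>"]
    by (simp only: subst_form_subst_form wf_subst_comp_subst)
qed (auto simp: wf_subst_push trm_step_subst_trm intro: form_step.intros)

lemma equivclp_map:
  assumes "equivclp r x y" "\<And>x y. r x y \<Longrightarrow> q (f x) (f y)"
  shows "equivclp q (f x) (f y)"
  using assms(1)
proof (induction rule: equivclp_induct)
  case (step y z)
  then show ?case
    using assms(2) by (meson equivclp_trans equivclp_sym r_into_equivclp)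
qed simp

lemma form_cong_map:
  assumes "form_cong L R A B" "wf_form L (f A)" "wf_form L (f B)"
    and "\<And>A B. form_rew L R A B \<Longrightarrow> form_rew L R (f A) (f B)"
  shows "form_cong L R (f A) (f B)"
  using assms equivclp_map[of "form_rew L R" A B "form_rew L R" f] by (auto simp: form_cong_def)

lemma form_cong_refl: "wf_form L A \<Longrightarrow> form_cong L R A A"
  by (simp add: form_cong_def)

lemma form_cong_sym: "form_cong L R A B \<Longrightarrow> form_cong L R B A"
  by (auto simp: form_cong_def intro: equivclp_sym)

lemma form_cong_trans [trans]: "form_cong L R A B \<Longrightarrow> form_cong L R B C \<Longrightarrow> form_cong L R A C"
  by (auto simp: form_cong_def intro: equivclp_trans)

lemma form_cong_wf: "form_cong L R A B \<Longrightarrow> wf_form L A" "form_cong L R A B \<Longrightarrow> wf_form L B"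
  by (auto simp: form_cong_def)

lemma form_cong_subst_form:
  assumes "form_cong L R A B" "wf_subst L \<theta>"
  shows "form_cong L R (subst_form \<theta> A) (subst_form \<theta> B)"
  using assms
  by (intro form_cong_map[where f = "subst_form \<theta>"])
    (auto simp: form_rew_def wf_form_subst_form form_step_subst_form dest: form_cong_wf)

lemma form_cong_subst_form_refl:
  "wf_form L A \<Longrightarrow> wf_subst L \<theta> \<Longrightarrow> form_cong L R (subst_form \<theta> A) (subst_form \<theta> A)"
  by (simp add: form_cong_refl wf_form_subst_form)

lemma form_cong_lift: "form_cong L R A B \<Longrightarrow> form_cong L R (lift s A) (lift s B)"
  by (simp add: lift_def form_cong_subst_form wf_subst_shift)

text \<open>A rewrite step changes only one side of a connective, so the two sides are replaced one
  after the other, through \<open>Imp A' B\<close>.\<close>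

lemma form_cong_Imp:
  assumes "form_cong L R A A'" "form_cong L R B B'"
  shows "form_cong L R (Imp A B) (Imp A' B')"
proof -
  have "form_cong L R (Imp A B) (Imp A' B)"
    using assms by (intro form_cong_map[where f = "\<lambda>X. Imp X B"])
      (auto simp: form_rew_def intro: form_step.intros dest: form_cong_wf)
  also have "form_cong L R (Imp A' B) (Imp A' B')"
    using assms by (intro form_cong_map[where f = "\<lambda>X. Imp A' X"])
      (auto simp: form_rew_def intro: form_step.intros dest: form_cong_wf)
  finally show ?thesis .
qed

lemma form_cong_And:
  assumes "form_cong L R A A'" "form_cong L R B B'"
  shows "form_cong L R (And A B) (And A' B')"
proof -
  have "form_cong L R (And A B) (And A' B)"
    using assms by (intro form_cong_map[where f = "\<lambda>X. And X B"])
      (auto simp: form_rew_def intro: form_step.intros dest: form_cong_wf)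
  also have "form_cong L R (And A' B) (And A' B')"
    using assms by (intro form_cong_map[where f = "\<lambda>X. And A' X"])
      (auto simp: form_rew_def intro: form_step.intros dest: form_cong_wf)
  finally show ?thesis .
qed

section \<open>Connectives are injective modulo a confluent congruence\<close>

inductive_cases form_step_ImpE: "form_step L R (Imp A B) C"
inductive_cases form_step_AndE: "form_step L R (And A B) C"
inductive_cases form_step_OrE: "form_step L R (Or A B) C"
inductive_cases form_step_ForallE: "form_step L R (Forall s A) C"
inductive_cases form_step_ExistsE: "form_step L R (Exists s A) C"

text \<open>Rules for propositions have atomic left-hand sides, so no step applies at the root of a
  compound proposition: the outermost connective survives, and the components reduce
  separately.\<close>

lemma form_rews_ImpE:
  assumes "(form_rew L R)\<^sup>*\<^sup>* (Imp A B) C"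
  obtains A' B' where "C = Imp A' B'" "(form_rew L R)\<^sup>*\<^sup>* A A'" "(form_rew L R)\<^sup>*\<^sup>* B B'"
proof -
  from assms
  have "\<exists>A' B'. C = Imp A' B' \<and> (form_rew L R)\<^sup>*\<^sup>* A A' \<and> (form_rew L R)\<^sup>*\<^sup>* B B'"
  proof (induction rule: rtranclp_induct)
    case (step C D)
    then obtain A' B' where C: "C = Imp A' B'"
      and rews: "(form_rew L R)\<^sup>*\<^sup>* A A'" "(form_rew L R)\<^sup>*\<^sup>* B B'"
      by blast
    \<comment> \<open>The reflexive closures account for the component that the step leaves
      alone.\<close>
    have "\<exists>A'' B''. D = Imp A'' B'' \<and> (form_rew L R)\<^sup>=\<^sup>= A' A'' \<and> (form_rew L R)\<^sup>=\<^sup>= B' B''"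
      using step.hyps(2) unfolding C form_rew_def by (auto elim: form_step_ImpE)
    then show ?case
      using rews by (blast intro: rtranclp.rtrancl_into_rtrancl)
  qed simp
  then show ?thesis using that by blast
qed

lemma form_rews_AndE:
  assumes "(form_rew L R)\<^sup>*\<^sup>* (And A B) C"
  obtains A' B' where "C = And A' B'" "(form_rew L R)\<^sup>*\<^sup>* A A'" "(form_rew L R)\<^sup>*\<^sup>* B B'"
proof -
  from assms
  have "\<exists>A' B'. C = And A' B' \<and> (form_rew L R)\<^sup>*\<^sup>* A A' \<and> (form_rew L R)\<^sup>*\<^sup>* B B'"
  proof (induction rule: rtranclp_induct)
    case (step C D)
    then obtain A' B' where C: "C = And A' B'"
      and rews: "(form_rew L R)\<^sup>*\<^sup>* A A'" "(form_rew L R)\<^sup>*\<^sup>* B B'"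
      by blast
    have "\<exists>A'' B''. D = And A'' B'' \<and> (form_rew L R)\<^sup>=\<^sup>= A' A'' \<and> (form_rew L R)\<^sup>=\<^sup>= B' B''"
      using step.hyps(2) unfolding C form_rew_def by (auto elim: form_step_AndE)
    then show ?case
      using rews by (blast intro: rtranclp.rtrancl_into_rtrancl)
  qed simp
  then show ?thesis using that by blast
qed

lemma form_rews_OrE:
  assumes "(form_rew L R)\<^sup>*\<^sup>* (Or A B) C"
  obtains A' B' where "C = Or A' B'" "(form_rew L R)\<^sup>*\<^sup>* A A'" "(form_rew L R)\<^sup>*\<^sup>* B B'"
proof -
  from assms
  have "\<exists>A' B'. C = Or A' B' \<and> (form_rew L R)\<^sup>*\<^sup>* A A' \<and> (form_rew L R)\<^sup>*\<^sup>* B B'"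
  proof (induction rule: rtranclp_induct)
    case (step C D)
    then obtain A' B' where C: "C = Or A' B'"
      and rews: "(form_rew L R)\<^sup>*\<^sup>* A A'" "(form_rew L R)\<^sup>*\<^sup>* B B'"
      by blast
    have "\<exists>A'' B''. D = Or A'' B'' \<and> (form_rew L R)\<^sup>=\<^sup>= A' A'' \<and> (form_rew L R)\<^sup>=\<^sup>= B' B''"
      using step.hyps(2) unfolding C form_rew_def by (auto elim: form_step_OrE)
    then show ?case
      using rews by (blast intro: rtranclp.rtrancl_into_rtrancl)
  qed simp
  then show ?thesis using that by blast
qed

lemma form_rews_ForallE:
  assumes "(form_rew L R)\<^sup>*\<^sup>* (Forall s A) C"
  obtains A' where "C = Forall s A'" "(form_rew L R)\<^sup>*\<^sup>* A A'"
proof -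
  from assms have "\<exists>A'. C = Forall s A' \<and> (form_rew L R)\<^sup>*\<^sup>* A A'"
  proof (induction rule: rtranclp_induct)
    case (step C D)
    then obtain A' where C: "C = Forall s A'" and rews: "(form_rew L R)\<^sup>*\<^sup>* A A'"
      by blast
    have "\<exists>A''. D = Forall s A'' \<and> form_rew L R A' A''"
      using step.hyps(2) unfolding C form_rew_def by (auto elim: form_step_ForallE)
    then show ?case
      using rews by (blast intro: rtranclp.rtrancl_into_rtrancl)
  qed simp
  then show ?thesis using that by blast
qed

lemma form_rews_ExistsE:
  assumes "(form_rew L R)\<^sup>*\<^sup>* (Exists s A) C"
  obtains A' where "C = Exists s A'" "(form_rew L R)\<^sup>*\<^sup>* A A'"
proof -
  from assms have "\<exists>A'. C = Exists s A' \<and> (form_rew L R)\<^sup>*\<^sup>* A A'"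
  proof (induction rule: rtranclp_induct)
    case (step C D)
    then obtain A' where C: "C = Exists s A'" and rews: "(form_rew L R)\<^sup>*\<^sup>* A A'"
      by blast
    have "\<exists>A''. D = Exists s A'' \<and> form_rew L R A' A''"
      using step.hyps(2) unfolding C form_rew_def by (auto elim: form_step_ExistsE)
    then show ?case
      using rews by (blast intro: rtranclp.rtrancl_into_rtrancl)
  qed simp
  then show ?thesis using that by blast
qed

text \<open>The Church-Rosser property: confluence turns a zigzag of steps into a common
  reduct.\<close>

lemma form_cong_join:
  assumes "confluent L R" "form_cong L R A B"
  obtains C where "(form_rew L R)\<^sup>*\<^sup>* A C" "(form_rew L R)\<^sup>*\<^sup>* B C"
proof -
  have "semiconfluentp (form_rew L R)"
    using assms(1) by (simp add: confluent_def confluentp_eq_semiconfluentp)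
  then have "((form_rew L R)\<^sup>*\<^sup>* OO (form_rew L R)\<inverse>\<inverse>\<^sup>*\<^sup>*) A B"
    using assms(2) by (simp add: semiconfluentp_equivclp form_cong_def)
  then show ?thesis
    using that by (auto simp: rtranclp_conversep)
qed

lemma form_cong_joinI:
  assumes "(form_rew L R)\<^sup>*\<^sup>* A C" "(form_rew L R)\<^sup>*\<^sup>* B C" "wf_form L A" "wf_form L B"
  shows "form_cong L R A B"
  using assms unfolding form_cong_def
  by (meson equivclp_sym equivclp_trans rtranclp_into_equivclp)

text \<open>The common reduct of the two implications is again an implication, and its components
  are common reducts of the respective components.\<close>

lemma form_cong_ImpD:
  assumes "confluent L R" "form_cong L R (Imp A B) (Imp A' B')"
  shows "form_cong L R A A'" "form_cong L R B B'"
  using assms(2) form_cong_wf[OF assms(2)]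
  by (auto elim!: form_cong_join[OF assms(1)] form_rews_ImpE intro: form_cong_joinI)

lemma form_cong_AndD:
  assumes "confluent L R" "form_cong L R (And A B) (And A' B')"
  shows "form_cong L R A A'" "form_cong L R B B'"
  using assms(2) form_cong_wf[OF assms(2)]
  by (auto elim!: form_cong_join[OF assms(1)] form_rews_AndE intro: form_cong_joinI)

lemma form_cong_OrD:
  assumes "confluent L R" "form_cong L R (Or A B) (Or A' B')"
  shows "form_cong L R A A'" "form_cong L R B B'"
  using assms(2) form_cong_wf[OF assms(2)]
  by (auto elim!: form_cong_join[OF assms(1)] form_rews_OrE intro: form_cong_joinI)

text \<open>The sorts are compared as well: \<open>seq_all\<close> below only provides some sort for
  its quantified proposition.\<close>

lemma form_cong_ForallD:
  assumes "confluent L R" "form_cong L R (Forall s A) (Forall s' A')"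
  shows "s = s'" "form_cong L R A A'"
  using assms(2) form_cong_wf[OF assms(2)]
  by (auto elim!: form_cong_join[OF assms(1)] form_rews_ForallE intro: form_cong_joinI)

lemma form_cong_ExistsD:
  assumes "confluent L R" "form_cong L R (Exists s A) (Exists s' A')"
  shows "s = s'" "form_cong L R A A'"
  using assms(2) form_cong_wf[OF assms(2)]
  by (auto elim!: form_cong_join[OF assms(1)] form_rews_ExistsE intro: form_cong_joinI)


section \<open>Cut-free sequents\<close>

lemma proves_wf:
  assumes "proves L R \<pi> \<Gamma> B"
  shows "wf_form L B" "\<forall>D \<in> set \<Gamma>. wf_form L D"
  using assms by induction (auto dest: form_cong_wf)

section \<open>Extensions of contexts by substitution and weakening\<close>

text \<open>The accessibility relation of a Kripke-style semantics. Substitution and weakening are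
  merged into one relation, so that lifting a context to make room for a fresh variable is an
  extension too; order and multiplicity in contexts are ignored.\<close>

definition context_ext ::
  "('s, 'f, 'p) lang \<Rightarrow> ('s, 'f) subst \<Rightarrow> ('s, 'f, 'p) form list \<Rightarrow> ('s, 'f, 'p) form list \<Rightarrow> bool"
  where "context_ext L \<theta> \<Gamma> \<Delta> \<longleftrightarrow>
    wf_subst L \<theta> \<and> (\<forall>D \<in> set \<Delta>. wf_form L D) \<and> subst_form \<theta> ` set \<Gamma> \<subseteq> set \<Delta>"

lemma context_ext_weaken:
  "\<forall>D \<in> set \<Delta>. wf_form L D \<Longrightarrow> set \<Gamma> \<subseteq> set \<Delta> \<Longrightarrow> context_ext L Var \<Gamma> \<Delta>"
  by (auto simp: context_ext_def wf_subst_Var)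

lemma context_ext_trans:
  "context_ext L \<theta> \<Gamma> \<Delta> \<Longrightarrow> context_ext L \<eta> \<Delta> \<Xi> \<Longrightarrow> context_ext L (comp_subst \<eta> \<theta>) \<Gamma> \<Xi>"
  unfolding context_ext_def
  by (auto simp: wf_subst_comp_subst subst_form_subst_form[symmetric] image_subset_iff)

lemma context_ext_Cons:
  "context_ext L \<theta> \<Gamma> \<Delta> \<Longrightarrow> wf_form L A \<Longrightarrow> context_ext L \<theta> (A # \<Gamma>) (subst_form \<theta> A # \<Delta>)"
  by (auto simp: context_ext_def wf_form_subst_form)

lemma context_ext_lift:
  "context_ext L \<theta> \<Gamma> \<Delta> \<Longrightarrow> context_ext L (push s \<theta>) (map (lift s) \<Gamma>) (map (lift s) \<Delta>)"
  by (auto simp: context_ext_def wf_subst_push subst_form_lift)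

lemma context_ext_shift:
  "\<forall>D \<in> set \<Gamma>. wf_form L D \<Longrightarrow> context_ext L (shift s) \<Gamma> (map (lift s) \<Gamma>)"
  by (auto simp: context_ext_def wf_subst_shift lift_def wf_form_subst_form)

text \<open>The proof tree \<open>\<pi>\<close> stays the same, hence cut-freeness and neutrality
  are preserved. A congruent conclusion is allowed at the same time because each rule can absorb it,
  either in its side condition or in its premises.\<close>

lemma proves_context_ext:
  assumes "proves L R \<pi> \<Gamma> B" "context_ext L \<theta> \<Gamma> \<Delta>" "form_cong L R B' (subst_form \<theta> B)"
  shows "proves L R \<pi> \<Delta> B'"
  using assms
proof (induction arbitrary: \<theta> \<Delta> B' rule: proves.induct)
  case (1 \<Gamma> A B)
  then have "form_cong L R B' (subst_form \<theta> A)"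
    by (meson context_ext_def form_cong_subst_form form_cong_trans)
  with 1 show ?case
    by (intro proves.intros(1)[of \<Delta> L "subst_form \<theta> A"]) (auto simp: context_ext_def)
next
  case (2 \<pi> A \<Gamma> B C)
  have wf: "wf_form L A" "wf_form L B" "wf_subst L \<theta>"
    using 2 by (auto simp: context_ext_def dest: form_cong_wf)
  have "proves L R \<pi> (subst_form \<theta> A # \<Delta>) (subst_form \<theta> B)"
    using 2 wf by (intro "2.IH"[of \<theta>] context_ext_Cons) (auto intro: form_cong_refl wf_form_subst_form)
  moreover have "form_cong L R B' (Imp (subst_form \<theta> A) (subst_form \<theta> B))"
    using form_cong_trans[OF "2.prems"(2) form_cong_subst_form[OF 2(2) wf(3)]] by simp
  ultimately show ?case by (rule proves.intros)
next
  case (3 \<pi> \<Gamma> C \<rho> A B)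
  have wf: "wf_form L A" "wf_form L B" "wf_form L C" "wf_subst L \<theta>"
    using 3 by (auto simp: context_ext_def dest: form_cong_wf)
  have "proves L R \<pi> \<Delta> (subst_form \<theta> C)" "proves L R \<rho> \<Delta> (subst_form \<theta> A)"
    using "3.IH"(1)[OF "3.prems"(1) form_cong_subst_form_refl[OF wf(3,4)]]
      "3.IH"(2)[OF "3.prems"(1) form_cong_subst_form_refl[OF wf(1,4)]] .
  \<comment> \<open>The conclusion of \<open>ImpE\<close> is a component of the eliminated
    implication, so the passage to \<open>B'\<close> is absorbed in the side condition.\<close>
  moreover have "form_cong L R (subst_form \<theta> C) (Imp (subst_form \<theta> A) B')"
    using form_cong_trans[OF form_cong_subst_form[OF 3(3) wf(4)], of "Imp (subst_form \<theta> A) B'"]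
      form_cong_Imp[OF form_cong_refl[OF wf_form_subst_form[OF wf(1,4)]] form_cong_sym[OF "3.prems"(2)]]
    by simp
  ultimately show ?case by (rule proves.intros)
next
  case (4 \<pi> \<Gamma> A \<rho> B C)
  have wf: "wf_form L A" "wf_form L B" "wf_subst L \<theta>"
    using 4 by (auto simp: context_ext_def dest: form_cong_wf)
  have "proves L R \<pi> \<Delta> (subst_form \<theta> A)" "proves L R \<rho> \<Delta> (subst_form \<theta> B)"
    using "4.IH"(1)[OF "4.prems"(1) form_cong_subst_form_refl[OF wf(1,3)]]
      "4.IH"(2)[OF "4.prems"(1) form_cong_subst_form_refl[OF wf(2,3)]] .
  moreover have "form_cong L R B' (And (subst_form \<theta> A) (subst_form \<theta> B))"
    using form_cong_trans[OF "4.prems"(2) form_cong_subst_form[OF 4(3) wf(3)]] by simp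
  ultimately show ?case by (rule proves.intros)
next
  case (5 \<pi> \<Gamma> C A B)
  have wf: "wf_form L A" "wf_form L B" "wf_form L C" "wf_subst L \<theta>"
    using 5 by (auto simp: context_ext_def dest: form_cong_wf)
  have "proves L R \<pi> \<Delta> (subst_form \<theta> C)"
    using "5.IH"[OF "5.prems"(1) form_cong_subst_form_refl[OF wf(3,4)]] .
  moreover have "form_cong L R (subst_form \<theta> C) (And B' (subst_form \<theta> B))"
    using form_cong_trans[OF form_cong_subst_form[OF 5(2) wf(4)], of "And B' (subst_form \<theta> B)"]
      form_cong_And[OF form_cong_sym[OF "5.prems"(2)] form_cong_refl[OF wf_form_subst_form[OF wf(2,4)]]]
    by simp
  ultimately show ?case by (rule proves.intros)
next
  case (6 \<pi> \<Gamma> C A B)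
  have wf: "wf_form L A" "wf_form L B" "wf_form L C" "wf_subst L \<theta>"
    using 6 by (auto simp: context_ext_def dest: form_cong_wf)
  have "proves L R \<pi> \<Delta> (subst_form \<theta> C)"
    using "6.IH"[OF "6.prems"(1) form_cong_subst_form_refl[OF wf(3,4)]] .
  moreover have "form_cong L R (subst_form \<theta> C) (And (subst_form \<theta> A) B')"
    using form_cong_trans[OF form_cong_subst_form[OF 6(2) wf(4)], of "And (subst_form \<theta> A) B'"]
      form_cong_And[OF form_cong_refl[OF wf_form_subst_form[OF wf(1,4)]] form_cong_sym[OF "6.prems"(2)]]
    by simp
  ultimately show ?case by (rule proves.intros)
next
  case (7 \<pi> \<Gamma> A C B)
  have wf: "wf_form L A" "wf_subst L \<theta>"
    using 7 by (auto simp: context_ext_def dest: form_cong_wf)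
  have "proves L R \<pi> \<Delta> (subst_form \<theta> A)"
    using "7.IH"[OF "7.prems"(1) form_cong_subst_form_refl[OF wf(1,2)]] .
  moreover have "form_cong L R B' (Or (subst_form \<theta> A) (subst_form \<theta> B))"
    using form_cong_trans[OF "7.prems"(2) form_cong_subst_form[OF 7(2) wf(2)]] by simp
  ultimately show ?case by (rule proves.intros)
next
  case (8 \<pi> \<Gamma> B C A)
  have wf: "wf_form L B" "wf_subst L \<theta>"
    using 8 by (auto simp: context_ext_def dest: form_cong_wf)
  have "proves L R \<pi> \<Delta> (subst_form \<theta> B)"
    using "8.IH"[OF "8.prems"(1) form_cong_subst_form_refl[OF wf(1,2)]] .
  moreover have "form_cong L R B' (Or (subst_form \<theta> A) (subst_form \<theta> B))"
    using form_cong_trans[OF "8.prems"(2) form_cong_subst_form[OF 8(2) wf(2)]] by simp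
  ultimately show ?case by (rule proves.intros)
next
  case (9 \<pi> \<Gamma> D \<rho> A C \<tau> B)
  have wf: "wf_form L A" "wf_form L B" "wf_form L D" "wf_subst L \<theta>"
    using 9 by (auto simp: context_ext_def dest: form_cong_wf)
  have "proves L R \<pi> \<Delta> (subst_form \<theta> D)"
    using "9.IH"(1)[OF "9.prems"(1) form_cong_subst_form_refl[OF wf(3,4)]] .
  \<comment> \<open>Here the minor premises carry the conclusion, so they absorb the passage to
    \<open>B'\<close>.\<close>
  moreover have "proves L R \<rho> (subst_form \<theta> A # \<Delta>) B'" "proves L R \<tau> (subst_form \<theta> B # \<Delta>) B'"
    using "9.IH"(2)[OF context_ext_Cons[OF "9.prems"(1) wf(1)] "9.prems"(2)]
      "9.IH"(3)[OF context_ext_Cons[OF "9.prems"(1) wf(2)] "9.prems"(2)] .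
  moreover have "form_cong L R (subst_form \<theta> D) (Or (subst_form \<theta> A) (subst_form \<theta> B))"
    using form_cong_subst_form[OF 9(4) wf(4)] by simp
  ultimately show ?case by (rule proves.intros)
next
  case (10 \<Gamma> A)
  then have "form_cong L R B' Top"
    using form_cong_trans[OF "10.prems"(2) form_cong_subst_form[OF 10(2)]]
    by (simp add: context_ext_def)
  with 10 show ?case
    by (intro proves.intros) (auto simp: context_ext_def)
next
  case (11 \<pi> \<Gamma> B A)
  have wf: "wf_form L B" "wf_subst L \<theta>"
    using 11 by (auto simp: context_ext_def dest: form_cong_wf)
  have "proves L R \<pi> \<Delta> (subst_form \<theta> B)"
    using "11.IH"[OF "11.prems"(1) form_cong_subst_form_refl[OF wf(1,2)]] .
  moreover have "form_cong L R (subst_form \<theta> B) Bot"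
    using form_cong_subst_form[OF 11(2) wf(2)] by simp
  ultimately show ?case
    using form_cong_wf[OF "11.prems"(2)] by (auto intro: proves.intros)
next
  case (12 \<pi> s \<Gamma> A B)
  have wf: "wf_form L A" "wf_subst L \<theta>"
    using 12 by (auto simp: context_ext_def dest: form_cong_wf)
  \<comment> \<open>Under the eigenvariable both contexts are lifted, and the pushed substitution
    relates the results.\<close>
  have "proves L R \<pi> (map (lift s) \<Delta>) (subst_form (push s \<theta>) A)"
    using 12 wf
    by (intro "12.IH"[of "push s \<theta>"] context_ext_lift)
      (auto intro: form_cong_refl wf_form_subst_form wf_subst_push)
  moreover have "form_cong L R B' (Forall s (subst_form (push s \<theta>) A))"
    using form_cong_trans[OF "12.prems"(2) form_cong_subst_form[OF 12(2) wf(2)]] by simp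
  ultimately show ?case by (rule proves.intros)
next
  case (13 \<pi> \<Gamma> B s A t C)
  have wf: "wf_form L B" "wf_subst L \<theta>"
    using 13 by (auto simp: context_ext_def dest: form_cong_wf)
  have "proves L R \<pi> \<Delta> (subst_form \<theta> B)"
    using "13.IH"[OF "13.prems"(1) form_cong_subst_form_refl[OF wf(1,2)]] .
  moreover have "form_cong L R (subst_form \<theta> B) (Forall s (subst_form (push s \<theta>) A))"
    using form_cong_subst_form[OF 13(2) wf(2)] by simp
  moreover have "has_sort L (subst_trm \<theta> t) s"
    using 13 wf by (simp add: has_sort_subst_trm)
  moreover have "form_cong L R B' (inst s (subst_trm \<theta> t) (subst_form (push s \<theta>) A))"
    using form_cong_trans[OF "13.prems"(2) form_cong_subst_form[OF 13(4) wf(2)]]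
    by (simp add: subst_form_inst inst_subst_form_push)
  ultimately show ?case by (rule proves.intros)
next
  case (14 \<pi> \<Gamma> C B s A t)
  have wf: "wf_form L C" "wf_subst L \<theta>"
    using 14 by (auto simp: context_ext_def dest: form_cong_wf)
  have "proves L R \<pi> \<Delta> (subst_form \<theta> C)"
    using "14.IH"[OF "14.prems"(1) form_cong_subst_form_refl[OF wf(1,2)]] .
  moreover have "form_cong L R B' (Exists s (subst_form (push s \<theta>) A))"
    using form_cong_trans[OF "14.prems"(2) form_cong_subst_form[OF 14(2) wf(2)]] by simp
  moreover have "has_sort L (subst_trm \<theta> t) s"
    using 14 wf by (simp add: has_sort_subst_trm)
  moreover have "form_cong L R (subst_form \<theta> C) (inst s (subst_trm \<theta> t) (subst_form (push s \<theta>) A))"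
    using form_cong_subst_form[OF 14(4) wf(2)]
    by (simp add: subst_form_inst inst_subst_form_push)
  ultimately show ?case by (rule proves.intros)
next
  case (15 \<pi> \<Gamma> C \<rho> A s B)
  have wf: "wf_form L A" "wf_form L C" "wf_subst L \<theta>"
    using 15 by (auto simp: context_ext_def dest: form_cong_wf)
  have "proves L R \<pi> \<Delta> (subst_form \<theta> C)"
    using "15.IH"(1)[OF "15.prems"(1) form_cong_subst_form_refl[OF wf(2,3)]] .
  moreover have "proves L R \<rho> (subst_form (push s \<theta>) A # map (lift s) \<Delta>) (lift s B')"
    using 15 wf form_cong_lift[OF "15.prems"(2), of s]
    by (intro "15.IH"(2)[of "push s \<theta>"] context_ext_Cons context_ext_lift)
      (auto simp: subst_form_lift)
  moreover have "form_cong L R (subst_form \<theta> C) (Exists s (subst_form (push s \<theta>) A))"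
    using form_cong_subst_form[OF 15(3) wf(3)] by simp
  ultimately show ?case by (rule proves.intros)
qed

section \<open>The deduction rules as closure properties of cut-free and of neutral cut-free
  sequents\<close>

definition cf_sequents ::
  "('s, 'f, 'p) lang \<Rightarrow> ('s, 'f, 'p) rewrite_system \<Rightarrow> ('s, 'f, 'p) sequent set" where
  "cf_sequents L R = {(\<Gamma>, B). \<exists>\<pi>. proves L R \<pi> \<Gamma> B \<and> cut_free \<pi>}"

definition ncf_sequents ::
  "('s, 'f, 'p) lang \<Rightarrow> ('s, 'f, 'p) rewrite_system \<Rightarrow> ('s, 'f, 'p) sequent set" where
  "ncf_sequents L R = {(\<Gamma>, B). \<exists>\<pi>. proves L R \<pi> \<Gamma> B \<and> cut_free \<pi> \<and> neutral \<pi>}"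

lemma ncf_subset_cf: "ncf_sequents L R \<subseteq> cf_sequents L R"
  by (auto simp: ncf_sequents_def cf_sequents_def)

lemma cf_wf: "(\<Gamma>, B) \<in> cf_sequents L R \<Longrightarrow> wf_form L B \<and> (\<forall>D \<in> set \<Gamma>. wf_form L D)"
  by (auto simp: cf_sequents_def dest: proves_wf)

lemma ncf_Axiom:
  "\<forall>D \<in> set \<Gamma>. wf_form L D \<Longrightarrow> A \<in> set \<Gamma> \<Longrightarrow> form_cong L R B A \<Longrightarrow>
    (\<Gamma>, B) \<in> ncf_sequents L R"
  unfolding cf_sequents_def ncf_sequents_def
  by (clarsimp, intro exI conjI, rule proves.intros(1)) (auto intro: cut_free.intros)

lemma cf_ImpI:
  "(A # \<Gamma>, B) \<in> cf_sequents L R \<Longrightarrow> form_cong L R C (Imp A B) \<Longrightarrow>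
    (\<Gamma>, C) \<in> cf_sequents L R"
  unfolding cf_sequents_def ncf_sequents_def
  by (clarsimp, intro exI conjI, rule proves.intros(2)) (auto intro: cut_free.intros)

text \<open>Only the major premise has to be neutral. The result is neutral again because it ends
  with an elimination; the same holds for the other elimination rules below.\<close>

lemma ncf_ImpE:
  "(\<Gamma>, C) \<in> ncf_sequents L R \<Longrightarrow> (\<Gamma>, A) \<in> cf_sequents L R \<Longrightarrow> form_cong L R C (Imp A B) \<Longrightarrow>
    (\<Gamma>, B) \<in> ncf_sequents L R"
  unfolding cf_sequents_def ncf_sequents_def
  by (clarsimp, intro exI conjI, rule proves.intros(3)) (auto intro: cut_free.intros)

lemma cf_AndI:
  "(\<Gamma>, A) \<in> cf_sequents L R \<Longrightarrow> (\<Gamma>, B) \<in> cf_sequents L R \<Longrightarrow> form_cong L R C (And A B) \<Longrightarrow>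
    (\<Gamma>, C) \<in> cf_sequents L R"
  unfolding cf_sequents_def ncf_sequents_def
  by (clarsimp, intro exI conjI, rule proves.intros(4)) (auto intro: cut_free.intros)

lemma ncf_AndE1:
  "(\<Gamma>, C) \<in> ncf_sequents L R \<Longrightarrow> form_cong L R C (And A B) \<Longrightarrow>
    (\<Gamma>, A) \<in> ncf_sequents L R"
  unfolding cf_sequents_def ncf_sequents_def
  by (clarsimp, intro exI conjI, rule proves.intros(5)) (auto intro: cut_free.intros)

lemma ncf_AndE2:
  "(\<Gamma>, C) \<in> ncf_sequents L R \<Longrightarrow> form_cong L R C (And A B) \<Longrightarrow>
    (\<Gamma>, B) \<in> ncf_sequents L R"
  unfolding cf_sequents_def ncf_sequents_def
  by (clarsimp, intro exI conjI, rule proves.intros(6)) (auto intro: cut_free.intros)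

lemma cf_OrI1:
  "(\<Gamma>, A) \<in> cf_sequents L R \<Longrightarrow> form_cong L R C (Or A B) \<Longrightarrow>
    (\<Gamma>, C) \<in> cf_sequents L R"
  unfolding cf_sequents_def ncf_sequents_def
  by (clarsimp, intro exI conjI, rule proves.intros(7)) (auto intro: cut_free.intros)

lemma cf_OrI2:
  "(\<Gamma>, B) \<in> cf_sequents L R \<Longrightarrow> form_cong L R C (Or A B) \<Longrightarrow>
    (\<Gamma>, C) \<in> cf_sequents L R"
  unfolding cf_sequents_def ncf_sequents_def
  by (clarsimp, intro exI conjI, rule proves.intros(8)) (auto intro: cut_free.intros)

lemma ncf_OrE:
  "(\<Gamma>, D) \<in> ncf_sequents L R \<Longrightarrow> (A # \<Gamma>, C) \<in> cf_sequents L R \<Longrightarrow>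
    (B # \<Gamma>, C) \<in> cf_sequents L R \<Longrightarrow> form_cong L R D (Or A B) \<Longrightarrow>
    (\<Gamma>, C) \<in> ncf_sequents L R"
  unfolding cf_sequents_def ncf_sequents_def
  by (clarsimp, intro exI conjI, rule proves.intros(9)) (auto intro: cut_free.intros)

lemma cf_TopI:
  "\<forall>D \<in> set \<Gamma>. wf_form L D \<Longrightarrow> form_cong L R A Top \<Longrightarrow>
    (\<Gamma>, A) \<in> cf_sequents L R"
  unfolding cf_sequents_def ncf_sequents_def
  by (clarsimp, intro exI conjI, rule proves.intros(10)) (auto intro: cut_free.intros)

lemma ncf_BotE:
  "(\<Gamma>, B) \<in> ncf_sequents L R \<Longrightarrow> form_cong L R B Bot \<Longrightarrow> wf_form L A \<Longrightarrow>
    (\<Gamma>, A) \<in> ncf_sequents L R"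
  unfolding cf_sequents_def ncf_sequents_def
  by (clarsimp, intro exI conjI, rule proves.intros(11)) (auto intro: cut_free.intros)

lemma cf_AllI:
  "(map (lift s) \<Gamma>, A) \<in> cf_sequents L R \<Longrightarrow> form_cong L R B (Forall s A) \<Longrightarrow>
    (\<Gamma>, B) \<in> cf_sequents L R"
  unfolding cf_sequents_def ncf_sequents_def
  by (clarsimp, intro exI conjI, rule proves.intros(12)) (auto intro: cut_free.intros)

lemma ncf_AllE:
  "(\<Gamma>, B) \<in> ncf_sequents L R \<Longrightarrow> form_cong L R B (Forall s A) \<Longrightarrow>
    has_sort L t s \<Longrightarrow> form_cong L R C (inst s t A) \<Longrightarrow>
    (\<Gamma>, C) \<in> ncf_sequents L R"
  unfolding cf_sequents_def ncf_sequents_def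
  by (clarsimp, intro exI conjI, rule proves.intros(13)) (auto intro: cut_free.intros)

lemma cf_ExI:
  "(\<Gamma>, C) \<in> cf_sequents L R \<Longrightarrow> form_cong L R B (Exists s A) \<Longrightarrow>
    has_sort L t s \<Longrightarrow> form_cong L R C (inst s t A) \<Longrightarrow>
    (\<Gamma>, B) \<in> cf_sequents L R"
  unfolding cf_sequents_def ncf_sequents_def
  by (clarsimp, intro exI conjI, rule proves.intros(14)) (auto intro: cut_free.intros)

lemma ncf_ExE:
  "(\<Gamma>, C) \<in> ncf_sequents L R \<Longrightarrow> (A # map (lift s) \<Gamma>, lift s B) \<in> cf_sequents L R \<Longrightarrow>
    form_cong L R C (Exists s A) \<Longrightarrow>
    (\<Gamma>, B) \<in> ncf_sequents L R"
  unfolding cf_sequents_def ncf_sequents_def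
  by (clarsimp, intro exI conjI, rule proves.intros(15)) (auto intro: cut_free.intros)


section \<open>The algebra of sequents\<close>

text \<open>The candidates are the analogue of reducibility candidates. Every candidate counts as positive
  in the algebra below, so that all axioms of truth values algebras reduce to closure properties; the
  logical content is in the elimination lemmas for the operations on candidates.\<close>

definition candidates ::
  "('s, 'f, 'p) lang \<Rightarrow> ('s, 'f, 'p) rewrite_system \<Rightarrow> ('s, 'f, 'p) sequent set set" where
  "candidates L R = {a. ncf_sequents L R \<subseteq> a \<and> a \<subseteq> cf_sequents L R \<and>
     (\<forall>\<Gamma> C \<theta> \<Delta> C'. (\<Gamma>, C) \<in> a \<longrightarrow> context_ext L \<theta> \<Gamma> \<Delta> \<longrightarrow>
        form_cong L R C' (subst_form \<theta> C) \<longrightarrow> (\<Delta>, C') \<in> a)}"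

lemma candidates_ncf: "a \<in> candidates L R \<Longrightarrow> x \<in> ncf_sequents L R \<Longrightarrow> x \<in> a"
  by (auto simp: candidates_def)

lemma candidates_cf: "a \<in> candidates L R \<Longrightarrow> x \<in> a \<Longrightarrow> x \<in> cf_sequents L R"
  by (auto simp: candidates_def)

lemma candidates_context_ext:
  "a \<in> candidates L R \<Longrightarrow> (\<Gamma>, C) \<in> a \<Longrightarrow> context_ext L \<theta> \<Gamma> \<Delta> \<Longrightarrow>
    form_cong L R C' (subst_form \<theta> C) \<Longrightarrow> (\<Delta>, C') \<in> a"
  unfolding candidates_def by blast

lemma candidates_subst:
  assumes "a \<in> candidates L R" "(\<Gamma>, C) \<in> a" "context_ext L \<theta> \<Gamma> \<Delta>"
  shows "(\<Delta>, subst_form \<theta> C) \<in> a"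
  using assms candidates_context_ext[OF assms form_cong_subst_form_refl]
    cf_wf[of \<Gamma> C L R] candidates_cf[OF assms(1,2)]
  by (simp add: context_ext_def)

lemma candidates_cong:
  assumes "a \<in> candidates L R" "(\<Gamma>, C) \<in> a" "form_cong L R C' C"
  shows "(\<Gamma>, C') \<in> a"
  using assms candidates_context_ext[OF assms(1,2) context_ext_weaken, of \<Gamma> C']
    cf_wf[of \<Gamma> C L R] candidates_cf[OF assms(1,2)]
  by simp

text \<open>All operations below add the neutral cut-free sequents to a specific set
  \<open>b\<close>. The neutral part is closed by \<open>proves_context_ext\<close>, so only
  \<open>b\<close> remains to be checked.\<close>

lemma candidatesI:
  assumes "a = ncf_sequents L R \<union> b" "b \<subseteq> cf_sequents L R"
    and "\<And>\<Gamma> C \<theta> \<Delta> C'. (\<Gamma>, C) \<in> b \<Longrightarrow> context_ext L \<theta> \<Gamma> \<Delta> \<Longrightarrow>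
      form_cong L R C' (subst_form \<theta> C) \<Longrightarrow> (\<Delta>, C') \<in> b"
  shows "a \<in> candidates L R"
  unfolding candidates_def
proof (intro CollectI conjI allI impI)
  fix \<Gamma> C \<theta> \<Delta> C'
  assume *: "(\<Gamma>, C) \<in> a" "context_ext L \<theta> \<Gamma> \<Delta>" "form_cong L R C' (subst_form \<theta> C)"
  show "(\<Delta>, C') \<in> a"
  proof (cases "(\<Gamma>, C) \<in> b")
    case True
    then show ?thesis using assms * by blast
  next
    case False
    then show ?thesis
      using assms(1) * by (auto simp: ncf_sequents_def intro: proves_context_ext)
  qed
qed (use assms(1,2) ncf_subset_cf[of L R] in auto)

section \<open>The operations on candidates\<close>

text \<open>A Kripke-style function space: quantifying over all extensions builds in closure under
  them. \<open>A\<close> and \<open>B\<close> are existential because \<open>C\<close> need only be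
  congruent to an implication; the choice is harmless by \<open>form_cong_ImpD\<close>. The context
  is required to be well-formed since the universal condition can hold vacuously.\<close>

definition seq_imp ::
  "('s, 'f, 'p) lang \<Rightarrow> ('s, 'f, 'p) rewrite_system \<Rightarrow> ('s, 'f, 'p) sequent set \<Rightarrow>
   ('s, 'f, 'p) sequent set \<Rightarrow> ('s, 'f, 'p) sequent set" where
  "seq_imp L R a b = ncf_sequents L R \<union>
     {(\<Gamma>, C). (\<forall>D \<in> set \<Gamma>. wf_form L D) \<and> (\<exists>A B. form_cong L R C (Imp A B) \<and>
        (\<forall>\<theta> \<Delta>. context_ext L \<theta> \<Gamma> \<Delta> \<longrightarrow> (\<Delta>, subst_form \<theta> A) \<in> a \<longrightarrow> (\<Delta>, subst_form \<theta> B) \<in> b))}"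

text \<open>Conjunction, and likewise disjunction, follows the introduction rules without
  quantifying over extensions: closure is inherited from the components.\<close>

definition seq_and ::
  "('s, 'f, 'p) lang \<Rightarrow> ('s, 'f, 'p) rewrite_system \<Rightarrow> ('s, 'f, 'p) sequent set \<Rightarrow>
   ('s, 'f, 'p) sequent set \<Rightarrow> ('s, 'f, 'p) sequent set" where
  "seq_and L R a b = ncf_sequents L R \<union>
     {(\<Gamma>, C). \<exists>A B. form_cong L R C (And A B) \<and> (\<Gamma>, A) \<in> a \<and> (\<Gamma>, B) \<in> b}"

definition seq_or ::
  "('s, 'f, 'p) lang \<Rightarrow> ('s, 'f, 'p) rewrite_system \<Rightarrow> ('s, 'f, 'p) sequent set \<Rightarrow>
   ('s, 'f, 'p) sequent set \<Rightarrow> ('s, 'f, 'p) sequent set" where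
  "seq_or L R a b = ncf_sequents L R \<union>
     {(\<Gamma>, C). \<exists>A B. form_cong L R C (Or A B) \<and> ((\<Gamma>, A) \<in> a \<or> (\<Gamma>, B) \<in> b)}"

text \<open>The instantiating term ranges independently of the truth value. The intersection with
  \<open>cf_sequents\<close> only matters for the empty family.\<close>

definition seq_all ::
  "('s, 'f, 'p) lang \<Rightarrow> ('s, 'f, 'p) rewrite_system \<Rightarrow> ('s, 'f, 'p) sequent set set \<Rightarrow>
   ('s, 'f, 'p) sequent set" where
  "seq_all L R S = ncf_sequents L R \<union>
     {(\<Gamma>, C). (\<forall>D \<in> set \<Gamma>. wf_form L D) \<and> (\<exists>s A. form_cong L R C (Forall s A) \<and>
        (\<forall>\<theta> \<Delta> t. context_ext L \<theta> \<Gamma> \<Delta> \<longrightarrow> has_sort L t s \<longrightarrow>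
           (\<Delta>, subst_form (scons s t \<theta>) A) \<in> cf_sequents L R \<inter> \<Inter>S))}"

text \<open>As for \<open>seq_all\<close>, term and truth value are not linked: some term is paired
  with some member of \<open>S\<close>.\<close>

definition seq_ex ::
  "('s, 'f, 'p) lang \<Rightarrow> ('s, 'f, 'p) rewrite_system \<Rightarrow> ('s, 'f, 'p) sequent set set \<Rightarrow>
   ('s, 'f, 'p) sequent set" where
  "seq_ex L R S = ncf_sequents L R \<union>
     {(\<Gamma>, C). \<exists>s A t. form_cong L R C (Exists s A) \<and> has_sort L t s \<and> (\<Gamma>, inst s t A) \<in> \<Union>S}"

text \<open>Top and bottom are the greatest and the least candidate, which makes them extremal for
  inclusion, the order used below.\<close>

definition sequent_tva ::
  "('s, 'f, 'p) lang \<Rightarrow> ('s, 'f, 'p) rewrite_system \<Rightarrow> ('s, 'f, 'p) sequent set tva" where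
  "sequent_tva L R =
     \<lparr>carrier = candidates L R, positive = candidates L R,
      all_dom = Pow (candidates L R), ex_dom = Pow (candidates L R),
      ttop = cf_sequents L R, tbot = ncf_sequents L R,
      timp = seq_imp L R, tand = seq_and L R, tor = seq_or L R,
      tall = seq_all L R, tex = seq_ex L R\<rparr>"

lemma ncf_candidate: "ncf_sequents L R \<in> candidates L R"
  by (rule candidatesI[where b = "{}"]) auto

lemma cf_candidate: "cf_sequents L R \<in> candidates L R"
proof (rule candidatesI[where b = "cf_sequents L R"])
  show "cf_sequents L R = ncf_sequents L R \<union> cf_sequents L R"
    using ncf_subset_cf by blast
qed (auto simp: cf_sequents_def intro: proves_context_ext)

lemma seq_imp_candidate:
  assumes a: "a \<in> candidates L R" and b: "b \<in> candidates L R"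
  shows "seq_imp L R a b \<in> candidates L R"
proof (rule candidatesI[OF seq_imp_def], safe)
  fix \<Gamma> C A B
  assume wf: "\<forall>D \<in> set \<Gamma>. wf_form L D" and C: "form_cong L R C (Imp A B)"
    and *: "\<forall>\<theta> \<Delta>. context_ext L \<theta> \<Gamma> \<Delta> \<longrightarrow> (\<Delta>, subst_form \<theta> A) \<in> a \<longrightarrow> (\<Delta>, subst_form \<theta> B) \<in> b"
  have A: "wf_form L A" using form_cong_wf[OF C] by simp
  \<comment> \<open>An axiom sequent is neutral and thus lies in every candidate. Applying the
    function-space condition to it over the weakened context \<open>A # \<Gamma>\<close> yields a
    premise for \<open>ImpI\<close>.\<close>
  have "(A # \<Gamma>, A) \<in> a"
    using wf A by (intro candidates_ncf[OF a] ncf_Axiom[of _ L A]) (auto intro: form_cong_refl)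
  moreover have "context_ext L Var \<Gamma> (A # \<Gamma>)"
    using wf A by (intro context_ext_weaken) auto
  ultimately have "(A # \<Gamma>, B) \<in> b"
    using * by fastforce
  then show "(\<Gamma>, C) \<in> cf_sequents L R"
    using candidates_cf[OF b] C by (blast intro: cf_ImpI)
next
  fix \<Gamma> C \<theta> \<Delta> C' A B
  assume ext: "context_ext L \<theta> \<Gamma> \<Delta>" and C': "form_cong L R C' (subst_form \<theta> C)"
    and C: "form_cong L R C (Imp A B)"
    and *: "\<forall>\<theta> \<Delta>. context_ext L \<theta> \<Gamma> \<Delta> \<longrightarrow> (\<Delta>, subst_form \<theta> A) \<in> a \<longrightarrow> (\<Delta>, subst_form \<theta> B) \<in> b"
  show "\<exists>A B. form_cong L R C' (Imp A B) \<and>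
    (\<forall>\<eta> \<Xi>. context_ext L \<eta> \<Delta> \<Xi> \<longrightarrow> (\<Xi>, subst_form \<eta> A) \<in> a \<longrightarrow> (\<Xi>, subst_form \<eta> B) \<in> b)"
  proof (intro exI conjI allI impI)
    show "form_cong L R C' (Imp (subst_form \<theta> A) (subst_form \<theta> B))"
      using form_cong_trans[OF C' form_cong_subst_form[OF C]] ext by (simp add: context_ext_def)
    \<comment> \<open>An extension of an extension of \<open>\<Gamma>\<close> is an extension of
      \<open>\<Gamma>\<close>, by the composed substitution.\<close>
    fix \<eta> \<Xi> assume "context_ext L \<eta> \<Delta> \<Xi>" "(\<Xi>, subst_form \<eta> (subst_form \<theta> A)) \<in> a"
    then show "(\<Xi>, subst_form \<eta> (subst_form \<theta> B)) \<in> b"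
      using * context_ext_trans[OF ext] by (simp add: subst_form_subst_form)
  qed
qed (auto simp: context_ext_def)

lemma seq_and_candidate:
  assumes a: "a \<in> candidates L R" and b: "b \<in> candidates L R"
  shows "seq_and L R a b \<in> candidates L R"
proof (rule candidatesI[OF seq_and_def], safe)
  fix \<Gamma> C A B
  assume "form_cong L R C (And A B)" "(\<Gamma>, A) \<in> a" "(\<Gamma>, B) \<in> b"
  then show "(\<Gamma>, C) \<in> cf_sequents L R"
    using candidates_cf[OF a] candidates_cf[OF b] by (blast intro: cf_AndI)
next
  fix \<Gamma> C \<theta> \<Delta> C' A B
  assume ext: "context_ext L \<theta> \<Gamma> \<Delta>" and C': "form_cong L R C' (subst_form \<theta> C)"
    and C: "form_cong L R C (And A B)" and AB: "(\<Gamma>, A) \<in> a" "(\<Gamma>, B) \<in> b"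
  have "form_cong L R C' (And (subst_form \<theta> A) (subst_form \<theta> B))"
    using form_cong_trans[OF C' form_cong_subst_form[OF C]] ext by (simp add: context_ext_def)
  with AB ext show "\<exists>A B. form_cong L R C' (And A B) \<and> (\<Delta>, A) \<in> a \<and> (\<Delta>, B) \<in> b"
    by (blast intro: candidates_subst[OF a] candidates_subst[OF b])
qed

lemma seq_or_candidate:
  assumes a: "a \<in> candidates L R" and b: "b \<in> candidates L R"
  shows "seq_or L R a b \<in> candidates L R"
proof (rule candidatesI[OF seq_or_def])
  show "{(\<Gamma>, C). \<exists>A B. form_cong L R C (Or A B) \<and> ((\<Gamma>, A) \<in> a \<or> (\<Gamma>, B) \<in> b)} \<subseteq> cf_sequents L R"
    using candidates_cf[OF a] candidates_cf[OF b] by (blast intro: cf_OrI1 cf_OrI2)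
next
  fix \<Gamma> C \<theta> \<Delta> C'
  assume ext: "context_ext L \<theta> \<Gamma> \<Delta>" and C': "form_cong L R C' (subst_form \<theta> C)"
    and "(\<Gamma>, C) \<in> {(\<Gamma>, C). \<exists>A B. form_cong L R C (Or A B) \<and> ((\<Gamma>, A) \<in> a \<or> (\<Gamma>, B) \<in> b)}"
  then obtain A B where C: "form_cong L R C (Or A B)" and AB: "(\<Gamma>, A) \<in> a \<or> (\<Gamma>, B) \<in> b"
    by blast
  have "form_cong L R C' (Or (subst_form \<theta> A) (subst_form \<theta> B))"
    using form_cong_trans[OF C' form_cong_subst_form[OF C]] ext by (simp add: context_ext_def)
  with AB ext
  show "(\<Delta>, C') \<in> {(\<Gamma>, C). \<exists>A B. form_cong L R C (Or A B) \<and> ((\<Gamma>, A) \<in> a \<or> (\<Gamma>, B) \<in> b)}"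
    by (blast intro: candidates_subst[OF a] candidates_subst[OF b])
qed

lemma seq_all_candidate: "seq_all L R S \<in> candidates L R"
proof -
  \<comment> \<open>Membership in \<open>I\<close> gives cut-freeness by itself, whatever
    \<open>S\<close> is.\<close>
  define I where "I = cf_sequents L R \<inter> \<Inter>S"
  define b where "b = {(\<Gamma>, C). (\<forall>D \<in> set \<Gamma>. wf_form L D) \<and> (\<exists>s A. form_cong L R C (Forall s A) \<and>
    (\<forall>\<theta> \<Delta> t. context_ext L \<theta> \<Gamma> \<Delta> \<longrightarrow> has_sort L t s \<longrightarrow> (\<Delta>, subst_form (scons s t \<theta>) A) \<in> I))}"
  show ?thesis
  proof (rule candidatesI)
    show "seq_all L R S = ncf_sequents L R \<union> b"
      unfolding seq_all_def b_def I_def ..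
    show "b \<subseteq> cf_sequents L R"
      unfolding b_def
    proof clarify
      fix \<Gamma> C s A
      assume wf: "\<forall>D \<in> set \<Gamma>. wf_form L D" and C: "form_cong L R C (Forall s A)"
        and *: "\<forall>\<theta> \<Delta> t. context_ext L \<theta> \<Gamma> \<Delta> \<longrightarrow> has_sort L t s \<longrightarrow>
          (\<Delta>, subst_form (scons s t \<theta>) A) \<in> I"
      \<comment> \<open>The generic instance: shift the context and instantiate by the fresh
        variable. The resulting substitution is the identity, so this is the premise of
        \<open>AllI\<close>.\<close>
      have "(map (lift s) \<Gamma>, subst_form (scons s (Var s 0) (shift s)) A) \<in> I"
        using *[rule_format, OF context_ext_shift[OF wf] has_sort.intros(1)] .
      then show "(\<Gamma>, C) \<in> cf_sequents L R"
        using cf_AllI[OF _ C] by (simp add: I_def)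
    qed
  next
    fix \<Gamma> C \<theta> \<Delta> C'
    assume ext: "context_ext L \<theta> \<Gamma> \<Delta>" and C': "form_cong L R C' (subst_form \<theta> C)"
      and "(\<Gamma>, C) \<in> b"
    then obtain s A where C: "form_cong L R C (Forall s A)"
      and *: "\<And>\<theta> \<Delta> t. context_ext L \<theta> \<Gamma> \<Delta> \<Longrightarrow> has_sort L t s \<Longrightarrow>
        (\<Delta>, subst_form (scons s t \<theta>) A) \<in> I"
      unfolding b_def by blast
    show "(\<Delta>, C') \<in> b"
      unfolding b_def
    proof (intro CollectI case_prodI conjI exI allI impI)
      show "\<forall>D \<in> set \<Delta>. wf_form L D"
        using ext by (simp add: context_ext_def)
      show "form_cong L R C' (Forall s (subst_form (push s \<theta>) A))"
        using form_cong_trans[OF C' form_cong_subst_form[OF C]] ext by (simp add: context_ext_def)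
      fix \<eta> \<Xi> t assume "context_ext L \<eta> \<Delta> \<Xi>" "has_sort L t s"
      then show "(\<Xi>, subst_form (scons s t \<eta>) (subst_form (push s \<theta>) A)) \<in> I"
        unfolding subst_form_subst_form comp_subst_scons_push by (intro * context_ext_trans[OF ext])
    qed
  qed
qed

lemma seq_ex_candidate:
  assumes "S \<subseteq> candidates L R"
  shows "seq_ex L R S \<in> candidates L R"
proof (rule candidatesI[OF seq_ex_def], safe)
  fix \<Gamma> C s A t a
  assume C: "form_cong L R C (Exists s A)" "has_sort L t s" and a: "(\<Gamma>, inst s t A) \<in> a" "a \<in> S"
  then have "(\<Gamma>, inst s t A) \<in> cf_sequents L R"
    using assms candidates_cf by blast
  then show "(\<Gamma>, C) \<in> cf_sequents L R"
    using C by (blast intro: cf_ExI form_cong_refl dest: cf_wf)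
next
  fix \<Gamma> C \<theta> \<Delta> C' s A t a
  assume ext: "context_ext L \<theta> \<Gamma> \<Delta>" and C': "form_cong L R C' (subst_form \<theta> C)"
    and C: "form_cong L R C (Exists s A)" and t: "has_sort L t s"
    and a: "(\<Gamma>, inst s t A) \<in> a" "a \<in> S"
  have "form_cong L R C' (Exists s (subst_form (push s \<theta>) A))"
    using form_cong_trans[OF C' form_cong_subst_form[OF C]] ext by (simp add: context_ext_def)
  moreover have "has_sort L (subst_trm \<theta> t) s"
    using ext t by (simp add: context_ext_def has_sort_subst_trm)
  moreover have "(\<Delta>, inst s (subst_trm \<theta> t) (subst_form (push s \<theta>) A)) \<in> a"
    using candidates_subst[OF _ a(1) ext] a(2) assms
    by (auto simp: subst_form_inst inst_subst_form_push)
  ultimately show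
    "\<exists>s A t. form_cong L R C' (Exists s A) \<and> has_sort L t s \<and> (\<Delta>, inst s t A) \<in> \<Union>S"
    using a(2) by blast
qed

section \<open>The candidates form a full, ordered and complete truth values algebra\<close>

lemma truth_values_algebra_sequent_tva: "truth_values_algebra (sequent_tva L R)"
proof
  fix a E
  assume "a \<in> carrier (sequent_tva L R)" "E \<in> ex_dom (sequent_tva L R)"
  then show "{e \<rightarrow>\<^bsub>sequent_tva L R\<^esub> a | e. e \<in> E} \<in> all_dom (sequent_tva L R)"
    by (auto simp: sequent_tva_def intro: seq_imp_candidate)
next
  fix E a
  assume "E \<in> ex_dom (sequent_tva L R)" "a \<in> E"
  then show "a \<rightarrow>\<^bsub>sequent_tva L R\<^esub> tex (sequent_tva L R) E \<in> positive (sequent_tva L R)"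
    by (auto simp: sequent_tva_def intro!: seq_imp_candidate seq_ex_candidate)
qed (auto simp: sequent_tva_def ncf_candidate cf_candidate seq_imp_candidate seq_and_candidate
    seq_or_candidate seq_all_candidate seq_ex_candidate)

lemma seq_imp_mono: "a' \<subseteq> a \<Longrightarrow> b \<subseteq> b' \<Longrightarrow> seq_imp L R a b \<subseteq> seq_imp L R a' b'"
  unfolding seq_imp_def by blast

text \<open>\<open>seq_all\<close> depends on the family only through its intersection, and the half
  of \<open>rel_set\<close> that gives each member of \<open>S'\<close> a lower member of
  \<open>S\<close> makes intersections grow. For \<open>seq_ex\<close> the other half and the union
  play these parts.\<close>

lemma seq_all_mono: "rel_set (\<subseteq>) S S' \<Longrightarrow> seq_all L R S \<subseteq> seq_all L R S'"
proof -
  assume "rel_set (\<subseteq>) S S'"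
  then have "\<Inter>S \<subseteq> \<Inter>S'" unfolding rel_set_def by blast
  then show ?thesis unfolding seq_all_def by blast
qed

lemma seq_ex_mono: "rel_set (\<subseteq>) S S' \<Longrightarrow> seq_ex L R S \<subseteq> seq_ex L R S'"
proof -
  assume "rel_set (\<subseteq>) S S'"
  then have "\<Union>S \<subseteq> \<Union>S'" unfolding rel_set_def by blast
  then show ?thesis unfolding seq_ex_def by blast
qed

lemma ordered_tva_sequent_tva:
  fixes L :: "('s, 'f, 'p) lang"
  shows "ordered_tva (sequent_tva L R) (\<subseteq>)"
proof -
  interpret truth_values_algebra "sequent_tva L R"
    by (rule truth_values_algebra_sequent_tva)
  show ?thesis
  proof
    show "reflp_on (carrier (sequent_tva L R)) (\<subseteq>)"
      by (auto intro: reflp_onI)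
    show "antisymp_on (carrier (sequent_tva L R)) (\<subseteq>)"
      by (auto intro: antisymp_onI)
    show "transp_on (carrier (sequent_tva L R)) (\<subseteq>)"
      by (auto intro: transp_onI)
  next
    fix a assume "a \<in> carrier (sequent_tva L R)" "ttop (sequent_tva L R) \<subseteq> a"
    then show "a = ttop (sequent_tva L R)"
      by (auto simp: sequent_tva_def candidates_def)
  next
    fix a assume "a \<in> carrier (sequent_tva L R)" "a \<subseteq> tbot (sequent_tva L R)"
    then show "a = tbot (sequent_tva L R)"
      by (auto simp: sequent_tva_def candidates_def)
  next
    fix a a' b b' :: "('s, 'f, 'p) sequent set" assume "a \<subseteq> a'" "b \<subseteq> b'"
    then show "tand (sequent_tva L R) a b \<subseteq> tand (sequent_tva L R) a' b'"
      "tor (sequent_tva L R) a b \<subseteq> tor (sequent_tva L R) a' b'"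
      by (auto simp: sequent_tva_def seq_and_def seq_or_def)
  qed (simp_all add: sequent_tva_def seq_imp_mono seq_all_mono seq_ex_mono)
qed

lemma full_tva_sequent_tva: "full_tva (sequent_tva L R)"
  by (simp add: full_tva_def sequent_tva_def)

text \<open>This supplies greatest lower bounds. The factor \<open>cf_sequents L R\<close> matters
  for empty \<open>X\<close>, where the bound is the greatest candidate.\<close>

lemma Inter_candidate:
  assumes "X \<subseteq> candidates L R"
  shows "cf_sequents L R \<inter> \<Inter>X \<in> candidates L R"
proof (rule candidatesI[where b = "cf_sequents L R \<inter> \<Inter>X"])
  show "cf_sequents L R \<inter> \<Inter>X = ncf_sequents L R \<union> cf_sequents L R \<inter> \<Inter>X"
    using assms ncf_subset_cf candidates_ncf by blast
next
  fix \<Gamma> C \<theta> \<Delta> C'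
  assume "(\<Gamma>, C) \<in> cf_sequents L R \<inter> \<Inter>X" "context_ext L \<theta> \<Gamma> \<Delta>"
    "form_cong L R C' (subst_form \<theta> C)"
  then show "(\<Delta>, C') \<in> cf_sequents L R \<inter> \<Inter>X"
    using assms candidates_context_ext[OF cf_candidate[of L R]]
      candidates_context_ext[of _ L R \<Gamma> C \<theta> \<Delta> C'] by blast
qed auto

lemma complete_tva_sequent_tva: "complete_tva (sequent_tva L R) (\<subseteq>)"
  unfolding complete_tva_def
proof (intro allI impI)
  fix X assume "X \<subseteq> carrier (sequent_tva L R)"
  then show "\<exists>g \<in> carrier (sequent_tva L R). (\<forall>x \<in> X. g \<subseteq> x) \<and>
    (\<forall>h \<in> carrier (sequent_tva L R). (\<forall>x \<in> X. h \<subseteq> x) \<longrightarrow> h \<subseteq> g)"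
    using Inter_candidate[of X L R] candidates_cf
    by (intro bexI[of _ "cf_sequents L R \<inter> \<Inter>X"]) (auto simp: sequent_tva_def)
qed

section \<open>Elimination principles for the operations on candidates\<close>

text \<open>This replaces cut reduction. If \<open>C\<close> has a neutral cut-free proof,
  \<open>ImpE\<close> may be applied to it. Otherwise \<open>C\<close> is known through some
  \<open>Imp A' B'\<close>, which confluence matches with \<open>Imp A B\<close> componentwise, and
  the function space is used at the identity extension.\<close>

lemma seq_imp_elim:
  assumes conf: "confluent L R" and a: "a \<in> candidates L R" and b: "b \<in> candidates L R"
    and C: "(\<Gamma>, C) \<in> seq_imp L R a b" "form_cong L R C (Imp A B)" and A: "(\<Gamma>, A) \<in> a"
  shows "(\<Gamma>, B) \<in> b"
proof (cases "(\<Gamma>, C) \<in> ncf_sequents L R")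
  case True
  then have "(\<Gamma>, B) \<in> ncf_sequents L R"
    using C(2) candidates_cf[OF a A] by (blast intro: ncf_ImpE)
  then show ?thesis using b by (rule candidates_ncf[rotated])
next
  case False
  then obtain A' B' where *: "\<forall>D \<in> set \<Gamma>. wf_form L D" "form_cong L R C (Imp A' B')"
    "\<forall>\<theta> \<Delta>. context_ext L \<theta> \<Gamma> \<Delta> \<longrightarrow> (\<Delta>, subst_form \<theta> A') \<in> a \<longrightarrow> (\<Delta>, subst_form \<theta> B') \<in> b"
    using C(1) by (auto simp: seq_imp_def)
  note inv = form_cong_ImpD[OF conf form_cong_trans[OF form_cong_sym[OF C(2)] *(2)]]
  have "(\<Gamma>, A') \<in> a"
    using candidates_cong[OF a A form_cong_sym[OF inv(1)]] .
  then have "(\<Gamma>, B') \<in> b"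
    using *(3)[rule_format, OF context_ext_weaken[OF *(1) subset_refl]] by simp
  then show ?thesis
    by (rule candidates_cong[OF b _ inv(2)])
qed

lemma seq_and_elim:
  assumes conf: "confluent L R" and a: "a \<in> candidates L R" and b: "b \<in> candidates L R"
    and C: "(\<Gamma>, C) \<in> seq_and L R a b" "form_cong L R C (And A B)"
  shows "(\<Gamma>, A) \<in> a" "(\<Gamma>, B) \<in> b"
proof -
  have "(\<Gamma>, A) \<in> a \<and> (\<Gamma>, B) \<in> b"
  proof (cases "(\<Gamma>, C) \<in> ncf_sequents L R")
    case True
    then have "(\<Gamma>, A) \<in> ncf_sequents L R" "(\<Gamma>, B) \<in> ncf_sequents L R"
      using C(2) by (blast intro: ncf_AndE1 ncf_AndE2)+
    then show ?thesis using a b by (blast intro: candidates_ncf)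
  next
    case False
    then obtain A' B' where *: "form_cong L R C (And A' B')" "(\<Gamma>, A') \<in> a" "(\<Gamma>, B') \<in> b"
      using C(1) by (auto simp: seq_and_def)
    note inv = form_cong_AndD[OF conf form_cong_trans[OF form_cong_sym[OF C(2)] *(1)]]
    show ?thesis
      using candidates_cong[OF a *(2) inv(1)] candidates_cong[OF b *(3) inv(2)] by blast
  qed
  then show "(\<Gamma>, A) \<in> a" "(\<Gamma>, B) \<in> b" by auto
qed

text \<open>The hypotheses on the two branches cover weakened contexts because a neutral
  \<open>D\<close> calls for the contexts \<open>A # \<Gamma>\<close> and
  \<open>B # \<Gamma>\<close>; a non-neutral one uses \<open>\<Gamma>\<close> itself.\<close>

lemma seq_or_elim:
  assumes conf: "confluent L R"
    and a: "a \<in> candidates L R" and b: "b \<in> candidates L R" and c: "c \<in> candidates L R"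
    and D: "(\<Gamma>, D) \<in> seq_or L R a b" "form_cong L R D (Or A B)"
    and ac: "\<And>\<Delta>. \<forall>D \<in> set \<Delta>. wf_form L D \<Longrightarrow> set \<Gamma> \<subseteq> set \<Delta> \<Longrightarrow> (\<Delta>, A) \<in> a \<Longrightarrow> (\<Delta>, C) \<in> c"
    and bc: "\<And>\<Delta>. \<forall>D \<in> set \<Delta>. wf_form L D \<Longrightarrow> set \<Gamma> \<subseteq> set \<Delta> \<Longrightarrow> (\<Delta>, B) \<in> b \<Longrightarrow> (\<Delta>, C) \<in> c"
  shows "(\<Gamma>, C) \<in> c"
proof -
  have "(\<Gamma>, D) \<in> cf_sequents L R"
    using D(1) candidates_cf[OF seq_or_candidate[OF a b]] by blast
  then have wf: "\<forall>D \<in> set \<Gamma>. wf_form L D" "wf_form L A" "wf_form L B"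
    using form_cong_wf[OF D(2)] by (auto dest: cf_wf)
  show ?thesis
  proof (cases "(\<Gamma>, D) \<in> ncf_sequents L R")
    case True
    have "(A # \<Gamma>, A) \<in> a" "(B # \<Gamma>, B) \<in> b"
      using wf by (simp_all add: candidates_ncf[OF a] candidates_ncf[OF b] ncf_Axiom[OF _ _ form_cong_refl])
    then have "(A # \<Gamma>, C) \<in> c" "(B # \<Gamma>, C) \<in> c"
      using wf ac[of "A # \<Gamma>"] bc[of "B # \<Gamma>"] by auto
    then have "(A # \<Gamma>, C) \<in> cf_sequents L R" "(B # \<Gamma>, C) \<in> cf_sequents L R"
      using candidates_cf[OF c] by auto
    then have "(\<Gamma>, C) \<in> ncf_sequents L R"
      using True D(2) by (blast intro: ncf_OrE)
    then show ?thesis using c by (rule candidates_ncf[rotated])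
  next
    case False
    then obtain A' B' where *: "form_cong L R D (Or A' B')" "(\<Gamma>, A') \<in> a \<or> (\<Gamma>, B') \<in> b"
      using D(1) by (auto simp: seq_or_def)
    note inv = form_cong_OrD[OF conf form_cong_trans[OF form_cong_sym[OF D(2)] *(1)]]
    show ?thesis
      using *(2) ac[OF wf(1)] bc[OF wf(1)] candidates_cong[OF a _ inv(1)]
        candidates_cong[OF b _ inv(2)] by blast
  qed
qed

lemma seq_all_elim:
  assumes conf: "confluent L R" and a: "a \<in> candidates L R" "a \<in> S"
    and B: "(\<Gamma>, B) \<in> seq_all L R S" "form_cong L R B (Forall s A)" and t: "has_sort L t s"
    and C: "form_cong L R C (inst s t A)"
  shows "(\<Gamma>, C) \<in> a"
proof (cases "(\<Gamma>, B) \<in> ncf_sequents L R")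
  case True
  then have "(\<Gamma>, C) \<in> ncf_sequents L R"
    using B(2) t C by (blast intro: ncf_AllE)
  then show ?thesis using a(1) by (rule candidates_ncf[rotated])
next
  case False
  then obtain s' A' where *: "\<forall>D \<in> set \<Gamma>. wf_form L D" "form_cong L R B (Forall s' A')"
    "\<forall>\<theta> \<Delta> t. context_ext L \<theta> \<Gamma> \<Delta> \<longrightarrow> has_sort L t s' \<longrightarrow>
      (\<Delta>, subst_form (scons s' t \<theta>) A') \<in> cf_sequents L R \<inter> \<Inter>S"
    using B(1) unfolding seq_all_def by blast
  note inv = form_cong_ForallD[OF conf form_cong_trans[OF form_cong_sym[OF B(2)] *(2)]]
  \<comment> \<open>The identity extension of \<open>\<Gamma>\<close> turns the general instance
    into \<open>inst s t A'\<close>.\<close>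
  have "(\<Gamma>, inst s t A') \<in> a"
    using *(3) t a(2) inv(1) context_ext_weaken[OF *(1) subset_refl] unfolding inst_def by blast
  moreover have "form_cong L R C (inst s t A')"
    using form_cong_trans[OF C] form_cong_subst_form[OF inv(2)] t
    by (simp add: inst_def wf_subst_scons wf_subst_Var)
  ultimately show ?thesis by (rule candidates_cong[OF a(1)])
qed

text \<open>Unlike for disjunction, the hypothesis on the branch allows a substitution: in the
  neutral case \<open>\<Gamma>\<close> and \<open>B\<close> have to be shifted to free the
  eigenvariable of \<open>ExE\<close>.\<close>

lemma seq_ex_elim:
  assumes conf: "confluent L R" and S: "S \<subseteq> candidates L R" "S \<noteq> {}" and b: "b \<in> candidates L R"
    and C: "(\<Gamma>, C) \<in> seq_ex L R S" "form_cong L R C (Exists s A)"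
    and ab: "\<And>\<theta> \<Delta> t a. context_ext L \<theta> \<Gamma> \<Delta> \<Longrightarrow> has_sort L t s \<Longrightarrow> a \<in> S \<Longrightarrow>
      (\<Delta>, subst_form (scons s t \<theta>) A) \<in> a \<Longrightarrow> (\<Delta>, subst_form \<theta> B) \<in> b"
  shows "(\<Gamma>, B) \<in> b"
proof -
  have "(\<Gamma>, C) \<in> cf_sequents L R"
    using C(1) candidates_cf[OF seq_ex_candidate[OF S(1)]] by blast
  then have wf: "\<forall>D \<in> set \<Gamma>. wf_form L D" "wf_form L A"
    using form_cong_wf[OF C(2)] by (auto dest: cf_wf)
  show ?thesis
  proof (cases "(\<Gamma>, C) \<in> ncf_sequents L R")
    case True
    \<comment> \<open>Any member will do, since the axiom sequent for \<open>A\<close> lies in all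
      of them; non-emptiness of \<open>S\<close> provides one.\<close>
    obtain a where a: "a \<in> S" using S(2) by blast
    have "(A # map (lift s) \<Gamma>, A) \<in> a"
      using wf a S(1) by (intro candidates_ncf[of a L R] ncf_Axiom[of _ L A]) (auto intro: form_cong_refl)
    moreover have "context_ext L (shift s) \<Gamma> (A # map (lift s) \<Gamma>)"
      using context_ext_shift[OF wf(1)] wf(2) by (auto simp: context_ext_def)
    \<comment> \<open>With \<open>shift s\<close> as substitution and the eigenvariable
      \<open>Var s 0\<close> as witness, the instance of \<open>A\<close> is \<open>A\<close>
      itself.\<close>
    ultimately have "(A # map (lift s) \<Gamma>, lift s B) \<in> b"
      using ab[of "shift s" _ "Var s 0" a] a by (simp add: has_sort.intros lift_def)
    then have "(A # map (lift s) \<Gamma>, lift s B) \<in> cf_sequents L R"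
      using b by (rule candidates_cf[rotated])
    then have "(\<Gamma>, B) \<in> ncf_sequents L R"
      using True C(2) by (blast intro: ncf_ExE)
    then show ?thesis using b by (rule candidates_ncf[rotated])
  next
    case False
    then obtain s' A' t a where *: "form_cong L R C (Exists s' A')" "has_sort L t s'"
      "(\<Gamma>, inst s' t A') \<in> a" "a \<in> S"
      using C(1) unfolding seq_ex_def by blast
    note inv = form_cong_ExistsD[OF conf form_cong_trans[OF form_cong_sym[OF C(2)] *(1)]]
    have "form_cong L R (inst s t A) (inst s t A')"
      using form_cong_subst_form[OF inv(2)] *(2) inv(1)
      by (simp add: inst_def wf_subst_scons wf_subst_Var)
    then have "(\<Gamma>, subst_form (scons s t Var) A) \<in> a"
      using candidates_cong[of a L R \<Gamma> "inst s t A'"] * S(1) inv(1) by (auto simp: inst_def)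
    then show ?thesis
      using ab[OF context_ext_weaken[OF wf(1) subset_refl]] * inv(1) by auto
  qed
qed


section \<open>Soundness\<close>

lemma den_trm_subst_trm:
  "den_trm M \<phi> (subst_trm \<sigma> t) = den_trm M (\<lambda>s n. den_trm M \<phi> (\<sigma> s n)) t"
  by (induction t) (auto simp: comp_def cong: map_cong)

lemma den_trm_shift: "den_trm M (scons s d \<phi>) (subst_trm (shift s) t) = den_trm M \<phi> t"
proof -
  have "(\<lambda>s' n. den_trm M (scons s d \<phi>) (shift s s' n)) = \<phi>"
    by (auto simp: shift_def scons_def fun_eq_iff)
  then show ?thesis by (simp add: den_trm_subst_trm)
qed

lemma den_trm_push:
  "(\<lambda>s' n. den_trm M (scons s d \<phi>) (push s \<sigma> s' n)) = scons s d (\<lambda>s' n. den_trm M \<phi> (\<sigma> s' n))"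
proof (intro ext)
  fix s' n
  show "den_trm M (scons s d \<phi>) (push s \<sigma> s' n) = scons s d (\<lambda>s' n. den_trm M \<phi> (\<sigma> s' n)) s' n"
    unfolding push_def
    by (cases "s' = s"; cases n) (simp_all add: scons_def den_trm_shift[unfolded scons_def])
qed

lemma den_subst_form:
  "den V M \<phi> (subst_form \<sigma> A) = den V M (\<lambda>s n. den_trm M \<phi> (\<sigma> s n)) A"
  by (induction A arbitrary: \<phi> \<sigma>)
    (simp_all add: den_trm_push den_trm_subst_trm comp_def cong: map_cong)

lemma den_lift: "den V M (scons s d \<phi>) (lift s A) = den V M \<phi> A"
proof -
  have "(\<lambda>s' n. den_trm M (scons s d \<phi>) (shift s s' n)) = \<phi>"
    by (auto simp: shift_def scons_def fun_eq_iff)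
  then show ?thesis by (simp add: lift_def den_subst_form)
qed

lemma den_inst: "den V M \<phi> (inst s t A) = den V M (scons s (den_trm M \<phi> t) \<phi>) A"
proof -
  have "(\<lambda>s' n. den_trm M \<phi> (scons s t Var s' n)) = scons s (den_trm M \<phi> t) \<phi>"
    by (auto simp: scons_def fun_eq_iff split: nat.split)
  then show ?thesis by (simp add: inst_def den_subst_form)
qed

lemma den_trm_in_domain:
  assumes "has_sort L t s" "wf_structure L V M" "assignment M \<phi>"
  shows "den_trm M \<phi> t \<in> domain_of M s"
  using assms(1)
proof (induction rule: has_sort.induct)
  case (1 s n)
  then show ?case using assms(3) by (simp add: assignment_def)
next
  case (2 f ss s ts)
  then have "list_all2 (\<lambda>x s. x \<in> domain_of M s) (map (den_trm M \<phi>) ts) ss"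
    by (auto simp: list_all2_conv_all_nth)
  then show ?case using 2 assms(2) by (simp add: wf_structure_def)
qed

lemma assignment_scons: "assignment M \<phi> \<Longrightarrow> d \<in> domain_of M s \<Longrightarrow> assignment M (scons s d \<phi>)"
  by (auto simp: assignment_def scons_def split: nat.split)

lemma den_in_carrier:
  assumes "truth_values_algebra V" "wf_structure L V M"
    and "wf_form L A" "assignment M \<phi>" "den_defined V M \<phi> A"
  shows "den V M \<phi> A \<in> carrier V"
proof -
  interpret truth_values_algebra V by fact
  show ?thesis using assms(3-)
  proof (induction A arbitrary: \<phi>)
    case (Atom P ts)
    then obtain ss where ss: "pred_rank L P = Some ss" "list_all2 (has_sort L) ts ss"
      by auto
    then have "list_all2 (\<lambda>x s. x \<in> domain_of M s) (map (den_trm M \<phi>) ts) ss"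
      using den_trm_in_domain[OF _ assms(2) Atom.prems(2)] by (auto simp: list_all2_conv_all_nth)
    then show ?case using ss assms(2) by (simp add: wf_structure_def)
  qed (auto intro: top_closed bot_closed imp_closed and_closed or_closed all_closed ex_closed)
qed

text \<open>The induction leaves \<open>\<phi>\<close>, \<open>\<sigma>\<close> and
  \<open>\<Delta>\<close> general: implication and quantifier rules move to extensions of
  \<open>\<Delta>\<close>, and going under a binder enlarges \<open>\<sigma>\<close> by a term and
  \<open>\<phi>\<close> by a domain element.\<close>

lemma soundness:
  assumes conf: "confluent L R" and model: "is_model L R (sequent_tva L R) M"
    and "proves L R \<pi> \<Gamma> B"
    and "assignment M \<phi>" "wf_subst L \<sigma>" "\<forall>D \<in> set \<Delta>. wf_form L D"
    and "\<forall>A \<in> set \<Gamma>. (\<Delta>, subst_form \<sigma> A) \<in> den (sequent_tva L R) M \<phi> A"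
  shows "(\<Delta>, subst_form \<sigma> B) \<in> den (sequent_tva L R) M \<phi> B"
proof -
  define D where "D = den (sequent_tva L R) M"
  have wfM: "wf_structure L (sequent_tva L R) M"
    using model by (simp add: is_model_def)
  have cand: "D \<phi> A \<in> candidates L R" if "wf_form L A" "assignment M \<phi>" for \<phi> A
    using den_in_carrier[OF truth_values_algebra_sequent_tva wfM that] model that
    unfolding is_model_def D_def by (simp add: sequent_tva_def)
  \<comment> \<open>The model property disposes of the congruence in all rules: congruent
    propositions denote the same candidate.\<close>
  have D_cong: "D \<phi> A = D \<phi> B" if "form_cong L R A B" "assignment M \<phi>" for \<phi> A B
    using model that unfolding is_model_def D_def by blast
  have D_simps: "D \<phi> Top = cf_sequents L R" "D \<phi> Bot = ncf_sequents L R"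
    "D \<phi> (Imp A B) = seq_imp L R (D \<phi> A) (D \<phi> B)"
    "D \<phi> (And A B) = seq_and L R (D \<phi> A) (D \<phi> B)"
    "D \<phi> (Or A B) = seq_or L R (D \<phi> A) (D \<phi> B)"
    "D \<phi> (Forall s A) = seq_all L R {D (scons s d \<phi>) A | d. d \<in> domain_of M s}"
    "D \<phi> (Exists s A) = seq_ex L R {D (scons s d \<phi>) A | d. d \<in> domain_of M s}" for \<phi> A B s
    by (simp_all add: D_def sequent_tva_def)
  have D_lift: "D (scons s d \<phi>) (lift s A) = D \<phi> A" for s d \<phi> A
    by (simp add: D_def den_lift)
  have D_inst: "D \<phi> (inst s t A) = D (scons s (den_trm M \<phi> t) \<phi>) A" for s t \<phi> A
    by (simp add: D_def den_inst)
  \<comment> \<open>Kripke monotonicity of the hypothesis on the context, inherited from the closure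
    of candidates.\<close>
  have ctx_ext: "\<forall>A \<in> set \<Gamma>. (\<Xi>, subst_form (comp_subst \<theta> \<sigma>) A) \<in> D \<phi> A"
    if "\<forall>A \<in> set \<Gamma>. (\<Delta>, subst_form \<sigma> A) \<in> D \<phi> A" "\<forall>A \<in> set \<Gamma>. wf_form L A"
      "assignment M \<phi>" "context_ext L \<theta> \<Delta> \<Xi>" for \<theta> \<sigma> \<phi> \<Gamma> \<Delta> \<Xi>
    using that candidates_subst[OF cand] unfolding subst_form_subst_form[symmetric] by blast
  from assms(3-) show ?thesis
    unfolding D_def[symmetric]
  proof (induction arbitrary: \<phi> \<sigma> \<Delta> rule: proves.induct)
    case (1 \<Gamma> A B)
    then show ?case
      using candidates_cong[OF cand _ form_cong_subst_form[OF 1(3)]] D_cong[OF 1(3)]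
      by (simp add: form_cong_wf[OF 1(3)])
  next
    case (2 \<pi> A \<Gamma> B C)
    have wf: "\<forall>D \<in> set \<Gamma>. wf_form L D" using proves_wf(2)[OF 2(1)] by simp
    have "(\<Delta>, subst_form \<sigma> C) \<in> seq_imp L R (D \<phi> A) (D \<phi> B)"
      unfolding seq_imp_def
    proof (intro UnI2 CollectI case_prodI conjI exI allI impI)
      show "form_cong L R (subst_form \<sigma> C) (Imp (subst_form \<sigma> A) (subst_form \<sigma> B))"
        using form_cong_subst_form[OF 2(2) "2.prems"(2)] by simp
      \<comment> \<open>The induction hypothesis is used at
        \<open>comp_subst \<theta> \<sigma>\<close>: the old hypotheses hold there by monotonicity,
        and \<open>A\<close> by assumption.\<close>
      fix \<theta> \<Xi> assume ext: "context_ext L \<theta> \<Delta> \<Xi>" and A: "(\<Xi>, subst_form \<theta> (subst_form \<sigma> A)) \<in> D \<phi> A"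
      then show "(\<Xi>, subst_form \<theta> (subst_form \<sigma> B)) \<in> D \<phi> B"
        using "2.IH"[OF "2.prems"(1), of "comp_subst \<theta> \<sigma>" \<Xi>] ctx_ext[OF "2.prems"(4) wf "2.prems"(1) ext]
          "2.prems"(2)
        by (simp add: subst_form_subst_form context_ext_def wf_subst_comp_subst)
    qed (use 2 in auto)
    then show ?case using D_cong[OF 2(2) "2.prems"(1)] by (simp add: D_simps)
  next
    case (3 \<pi> \<Gamma> C \<rho> A B)
    have wf: "wf_form L A" "wf_form L B" using form_cong_wf[OF 3(3)] by auto
    show ?case
    proof (rule seq_imp_elim[OF conf cand cand])
      show "(\<Delta>, subst_form \<sigma> C) \<in> seq_imp L R (D \<phi> A) (D \<phi> B)"
        using "3.IH"(1)[OF "3.prems"] D_cong[OF 3(3) "3.prems"(1)] by (simp add: D_simps)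
      show "form_cong L R (subst_form \<sigma> C) (Imp (subst_form \<sigma> A) (subst_form \<sigma> B))"
        using form_cong_subst_form[OF 3(3) "3.prems"(2)] by simp
    qed (use wf 3 in auto)
  next
    case (4 \<pi> \<Gamma> A \<rho> B C)
    have "form_cong L R (subst_form \<sigma> C) (And (subst_form \<sigma> A) (subst_form \<sigma> B))"
      using form_cong_subst_form[OF 4(3) "4.prems"(2)] by simp
    then show ?case
      using "4.IH"(1)[OF "4.prems"] "4.IH"(2)[OF "4.prems"] D_cong[OF 4(3) "4.prems"(1)]
      by (auto simp: D_simps seq_and_def)
  next
    case (5 \<pi> \<Gamma> C A B)
    have "form_cong L R (subst_form \<sigma> C) (And (subst_form \<sigma> A) (subst_form \<sigma> B))"
      using form_cong_subst_form[OF 5(2) "5.prems"(2)] by simp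
    moreover have "(\<Delta>, subst_form \<sigma> C) \<in> seq_and L R (D \<phi> A) (D \<phi> B)"
      using "5.IH"[OF "5.prems"] D_cong[OF 5(2) "5.prems"(1)] by (simp add: D_simps)
    ultimately show ?case
      using seq_and_elim(1)[OF conf cand cand] form_cong_wf[OF 5(2)] "5.prems"(1) by auto
  next
    case (6 \<pi> \<Gamma> C A B)
    have "form_cong L R (subst_form \<sigma> C) (And (subst_form \<sigma> A) (subst_form \<sigma> B))"
      using form_cong_subst_form[OF 6(2) "6.prems"(2)] by simp
    moreover have "(\<Delta>, subst_form \<sigma> C) \<in> seq_and L R (D \<phi> A) (D \<phi> B)"
      using "6.IH"[OF "6.prems"] D_cong[OF 6(2) "6.prems"(1)] by (simp add: D_simps)
    ultimately show ?case
      using seq_and_elim(2)[OF conf cand cand] form_cong_wf[OF 6(2)] "6.prems"(1) by auto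
  next
    case (7 \<pi> \<Gamma> A C B)
    have "form_cong L R (subst_form \<sigma> C) (Or (subst_form \<sigma> A) (subst_form \<sigma> B))"
      using form_cong_subst_form[OF 7(2) "7.prems"(2)] by simp
    then show ?case
      using "7.IH"[OF "7.prems"] D_cong[OF 7(2) "7.prems"(1)] by (auto simp: D_simps seq_or_def)
  next
    case (8 \<pi> \<Gamma> B C A)
    have "form_cong L R (subst_form \<sigma> C) (Or (subst_form \<sigma> A) (subst_form \<sigma> B))"
      using form_cong_subst_form[OF 8(2) "8.prems"(2)] by simp
    then show ?case
      using "8.IH"[OF "8.prems"] D_cong[OF 8(2) "8.prems"(1)] by (auto simp: D_simps seq_or_def)
  next
    case (9 \<pi> \<Gamma> E \<rho> A C \<tau> B)
    have wf: "wf_form L A" "wf_form L B" using form_cong_wf[OF 9(4)] by auto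
    have wf': "\<forall>D \<in> set \<Gamma>. wf_form L D" using proves_wf(2)[OF 9(1)] .
    show ?case
    proof (rule seq_or_elim[OF conf cand cand cand])
      show "(\<Delta>, subst_form \<sigma> E) \<in> seq_or L R (D \<phi> A) (D \<phi> B)"
        using "9.IH"(1)[OF "9.prems"] D_cong[OF 9(4) "9.prems"(1)] by (simp add: D_simps)
      show "form_cong L R (subst_form \<sigma> E) (Or (subst_form \<sigma> A) (subst_form \<sigma> B))"
        using form_cong_subst_form[OF 9(4) "9.prems"(2)] by simp
    next
      fix \<Xi> assume \<Xi>: "\<forall>D \<in> set \<Xi>. wf_form L D" "set \<Delta> \<subseteq> set \<Xi>"
      note * = ctx_ext[OF "9.prems"(4) wf' "9.prems"(1) context_ext_weaken[OF \<Xi>]]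
      show "(\<Xi>, subst_form \<sigma> C) \<in> D \<phi> C" if "(\<Xi>, subst_form \<sigma> A) \<in> D \<phi> A"
        using "9.IH"(2)[OF "9.prems"(1,2) \<Xi>(1)] * that by simp
      show "(\<Xi>, subst_form \<sigma> C) \<in> D \<phi> C" if "(\<Xi>, subst_form \<sigma> B) \<in> D \<phi> B"
        using "9.IH"(3)[OF "9.prems"(1,2) \<Xi>(1)] * that by simp
    qed (use wf 9 proves_wf(1)[OF 9(2)] in auto)
  next
    case (10 \<Gamma> A)
    have "form_cong L R (subst_form \<sigma> A) Top"
      using form_cong_subst_form[OF 10(2) "10.prems"(2)] by simp
    then show ?case
      using "10.prems"(3) D_cong[OF 10(2) "10.prems"(1)] by (simp add: D_simps cf_TopI)
  next
    case (11 \<pi> \<Gamma> B A)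
    have "(\<Delta>, subst_form \<sigma> B) \<in> ncf_sequents L R"
      using "11.IH"[OF "11.prems"] D_cong[OF 11(2) "11.prems"(1)] by (simp add: D_simps)
    moreover have "form_cong L R (subst_form \<sigma> B) Bot"
      using form_cong_subst_form[OF 11(2) "11.prems"(2)] by simp
    \<comment> \<open>Absurdity denotes the neutral cut-free sequents, so \<open>BotE\<close> yields
      a neutral sequent, which belongs to every candidate.\<close>
    ultimately have "(\<Delta>, subst_form \<sigma> A) \<in> ncf_sequents L R"
      by (rule ncf_BotE) (rule wf_form_subst_form[OF 11(3) "11.prems"(2)])
    then show ?case
      using candidates_ncf[OF cand[OF 11(3) "11.prems"(1)]] by blast
  next
    case (12 \<pi> s \<Gamma> A B)
    have wf: "wf_form L A" "\<forall>D \<in> set \<Gamma>. wf_form L D"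
      using proves_wf[OF 12(1)] by auto
    \<comment> \<open>The term \<open>t\<close> and the domain element \<open>d\<close> vary
      independently, as \<open>seq_all\<close> demands. The lifted context is insensitive to
      both.\<close>
    have inst: "(\<Xi>, subst_form (scons s t \<theta>) (subst_form (push s \<sigma>) A)) \<in> D (scons s d \<phi>) A"
      if ext: "context_ext L \<theta> \<Delta> \<Xi>" and t: "has_sort L t s" and d: "d \<in> domain_of M s" for \<theta> \<Xi> t d
    proof -
      have "wf_subst L (scons s t (comp_subst \<theta> \<sigma>))" "\<forall>D \<in> set \<Xi>. wf_form L D"
        using ext t "12.prems"(2) by (auto simp: context_ext_def wf_subst_scons wf_subst_comp_subst)
      moreover have "\<forall>A \<in> set (map (lift s) \<Gamma>).
        (\<Xi>, subst_form (scons s t (comp_subst \<theta> \<sigma>)) A) \<in> D (scons s d \<phi>) A"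
        using ctx_ext[OF "12.prems"(4) wf(2) "12.prems"(1) ext] by (simp add: subst_form_lift D_lift)
      ultimately show ?thesis
        using "12.IH"[OF assignment_scons[OF "12.prems"(1) d]]
        by (simp add: subst_form_subst_form comp_subst_scons_push)
    qed
    \<comment> \<open>One element of the non-empty domain suffices to obtain the factor
      \<open>cf_sequents L R\<close> of \<open>seq_all\<close>.\<close>
    obtain d where d: "d \<in> domain_of M s"
      using wfM by (fastforce simp: wf_structure_def)
    have "(\<Delta>, subst_form \<sigma> B) \<in> seq_all L R {D (scons s d \<phi>) A | d. d \<in> domain_of M s}"
      unfolding seq_all_def
    proof (intro UnI2 CollectI case_prodI conjI exI allI impI)
      show "form_cong L R (subst_form \<sigma> B) (Forall s (subst_form (push s \<sigma>) A))"
        using form_cong_subst_form[OF 12(2) "12.prems"(2)] by simp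
      fix \<theta> \<Xi> t assume *: "context_ext L \<theta> \<Delta> \<Xi>" "has_sort L t s"
      have "(\<Xi>, subst_form (scons s t \<theta>) (subst_form (push s \<sigma>) A)) \<in> cf_sequents L R"
        using inst[OF * d] candidates_cf[OF cand[OF wf(1) assignment_scons[OF "12.prems"(1) d]]]
        by blast
      then show "(\<Xi>, subst_form (scons s t \<theta>) (subst_form (push s \<sigma>) A))
          \<in> cf_sequents L R \<inter> \<Inter>{D (scons s d \<phi>) A | d. d \<in> domain_of M s}"
        using inst[OF *] by blast
    qed (use 12 in auto)
    then show ?case using D_cong[OF 12(2) "12.prems"(1)] by (simp add: D_simps)
  next
    case (13 \<pi> \<Gamma> B s A t C)
    have wf: "wf_form L A" using form_cong_wf[OF 13(2)] by simp
    have d: "den_trm M \<phi> t \<in> domain_of M s"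
      by (rule den_trm_in_domain[OF 13(3) wfM "13.prems"(1)])
    \<comment> \<open>Of all members of the family, the one at the denotation of \<open>t\<close> is
      taken, since it equals the denotation of \<open>inst s t A\<close>.\<close>
    have "(\<Delta>, subst_form \<sigma> C) \<in> D (scons s (den_trm M \<phi> t) \<phi>) A"
    proof (rule seq_all_elim[OF conf cand[OF wf assignment_scons[OF "13.prems"(1) d]]])
      show "(\<Delta>, subst_form \<sigma> B) \<in> seq_all L R {D (scons s d \<phi>) A | d. d \<in> domain_of M s}"
        using "13.IH"[OF "13.prems"] D_cong[OF 13(2) "13.prems"(1)] by (simp add: D_simps)
      show "form_cong L R (subst_form \<sigma> B) (Forall s (subst_form (push s \<sigma>) A))"
        using form_cong_subst_form[OF 13(2) "13.prems"(2)] by simp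
      show "has_sort L (subst_trm \<sigma> t) s"
        by (rule has_sort_subst_trm[OF 13(3) "13.prems"(2)])
      show "form_cong L R (subst_form \<sigma> C) (inst s (subst_trm \<sigma> t) (subst_form (push s \<sigma>) A))"
        using form_cong_subst_form[OF 13(4) "13.prems"(2)]
        by (simp add: subst_form_inst inst_subst_form_push)
    qed (use d in auto)
    then show ?case using D_cong[OF 13(4) "13.prems"(1)] by (simp add: D_inst)
  next
    case (14 \<pi> \<Gamma> C B s A t)
    have d: "den_trm M \<phi> t \<in> domain_of M s"
      by (rule den_trm_in_domain[OF 14(3) wfM "14.prems"(1)])
    have wf: "wf_form L A" using form_cong_wf[OF 14(2)] by simp
    have "form_cong L R (inst s (subst_trm \<sigma> t) (subst_form (push s \<sigma>) A)) (subst_form \<sigma> C)"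
      using form_cong_sym[OF form_cong_subst_form[OF 14(4) "14.prems"(2)]]
      by (simp add: subst_form_inst inst_subst_form_push)
    \<comment> \<open>The witnesses for \<open>seq_ex\<close> are the term
      \<open>subst_trm \<sigma> t\<close> and the truth value at the denotation of
      \<open>t\<close>.\<close>
    moreover have "(\<Delta>, subst_form \<sigma> C) \<in> D (scons s (den_trm M \<phi> t) \<phi>) A"
      using "14.IH"[OF "14.prems"] D_cong[OF 14(4) "14.prems"(1)] by (simp add: D_inst)
    ultimately have "(\<Delta>, inst s (subst_trm \<sigma> t) (subst_form (push s \<sigma>) A))
        \<in> D (scons s (den_trm M \<phi> t) \<phi>) A"
      by (rule candidates_cong[OF cand[OF wf assignment_scons[OF "14.prems"(1) d]], rotated])
    moreover have "form_cong L R (subst_form \<sigma> B) (Exists s (subst_form (push s \<sigma>) A))"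
      using form_cong_subst_form[OF 14(2) "14.prems"(2)] by simp
    moreover have "has_sort L (subst_trm \<sigma> t) s"
      by (rule has_sort_subst_trm[OF 14(3) "14.prems"(2)])
    ultimately have "(\<Delta>, subst_form \<sigma> B) \<in> seq_ex L R {D (scons s d \<phi>) A | d. d \<in> domain_of M s}"
      unfolding seq_ex_def using d by blast
    then show ?case using D_cong[OF 14(2) "14.prems"(1)] by (simp add: D_simps)
  next
    case (15 \<pi> \<Gamma> C \<rho> A s B)
    have wf: "wf_form L A" "wf_form L B" "\<forall>D \<in> set \<Gamma>. wf_form L D"
      using proves_wf[OF 15(2)] by auto
    show ?case
    proof (rule seq_ex_elim[OF conf _ _ cand[OF wf(2) "15.prems"(1)]])
      show "{D (scons s d \<phi>) A | d. d \<in> domain_of M s} \<subseteq> candidates L R"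
        using cand[OF wf(1)] assignment_scons[OF "15.prems"(1)] by blast
      show "{D (scons s d \<phi>) A | d. d \<in> domain_of M s} \<noteq> {}"
        using wfM by (fastforce simp: wf_structure_def)
      show "(\<Delta>, subst_form \<sigma> C) \<in> seq_ex L R {D (scons s d \<phi>) A | d. d \<in> domain_of M s}"
        using "15.IH"(1)[OF "15.prems"] D_cong[OF 15(3) "15.prems"(1)] by (simp add: D_simps)
      show "form_cong L R (subst_form \<sigma> C) (Exists s (subst_form (push s \<sigma>) A))"
        using form_cong_subst_form[OF 15(3) "15.prems"(2)] by simp
    next
      fix \<theta> \<Xi> t a
      assume ext: "context_ext L \<theta> \<Delta> \<Xi>" and t: "has_sort L t s"
        and "a \<in> {D (scons s d \<phi>) A | d. d \<in> domain_of M s}"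
        and A: "(\<Xi>, subst_form (scons s t \<theta>) (subst_form (push s \<sigma>) A)) \<in> a"
      then obtain d where d: "d \<in> domain_of M s" and a: "a = D (scons s d \<phi>) A" by blast
      have "wf_subst L (scons s t (comp_subst \<theta> \<sigma>))" "\<forall>D \<in> set \<Xi>. wf_form L D"
        using ext t "15.prems"(2) by (auto simp: context_ext_def wf_subst_scons wf_subst_comp_subst)
      \<comment> \<open>The head of the context holds by the assumption on the instance, the lifted
        rest by monotonicity, for this \<open>t\<close> and this \<open>d\<close> alike.\<close>
      moreover have "\<forall>A \<in> set (A # map (lift s) \<Gamma>).
        (\<Xi>, subst_form (scons s t (comp_subst \<theta> \<sigma>)) A) \<in> D (scons s d \<phi>) A"
        using ctx_ext[OF "15.prems"(4) wf(3) "15.prems"(1) ext] A a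
        by (simp add: subst_form_lift D_lift subst_form_subst_form comp_subst_scons_push)
      ultimately show "(\<Xi>, subst_form \<theta> (subst_form \<sigma> B)) \<in> D \<phi> B"
        using "15.IH"(2)[OF assignment_scons[OF "15.prems"(1) d], of "scons s t (comp_subst \<theta> \<sigma>)" \<Xi>]
        by (simp add: subst_form_lift D_lift subst_form_subst_form)
    qed
  qed
qed

theorem mainTheorem1:
  fixes L :: "('s, 'f, 'p) lang"
    and R :: "('s, 'f, 'p) rewrite_system"
    and \<Gamma> :: "('s, 'f, 'p) form list"
    and B :: "('s, 'f, 'p) form"
  assumes "wf_rewrite_system L R"
    and "confluent L R"
    and "super_consistent TYPE(('s, 'f, 'p) sequent set) TYPE('m) L R"
    and "\<exists>\<pi>. proves L R \<pi> \<Gamma> B"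
  shows "\<exists>\<pi>. proves L R \<pi> \<Gamma> B \<and> cut_free \<pi>"
proof -
  let ?V = "sequent_tva L R"
  obtain M :: "('s, 'f, 'p, 'm, ('s, 'f, 'p) sequent set) fo_structure"
    where M: "is_model L R ?V M"
    using assms(3) ordered_tva_sequent_tva full_tva_sequent_tva complete_tva_sequent_tva
    unfolding super_consistent_def by blast
  have wfM: "wf_structure L ?V M" using M by (simp add: is_model_def)
  \<comment> \<open>Any assignment will do; one exists because the domains are non-empty.\<close>
  define \<phi> :: "'s \<Rightarrow> nat \<Rightarrow> 'm" where "\<phi> s n = (SOME d. d \<in> domain_of M s)" for s n
  have \<phi>: "assignment M \<phi>"
    using wfM by (auto simp: assignment_def \<phi>_def wf_structure_def some_in_eq)
  have cand: "den ?V M \<phi> A \<in> candidates L R" if "wf_form L A" for A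
    using den_in_carrier[OF truth_values_algebra_sequent_tva wfM that \<phi>] M that \<phi>
    unfolding is_model_def by (simp add: sequent_tva_def)
  obtain \<pi> where \<pi>: "proves L R \<pi> \<Gamma> B" using assms(4) by blast
  note wf = proves_wf[OF \<pi>]
  \<comment> \<open>Each hypothesis follows from \<open>\<Gamma>\<close> by an axiom, which is
    neutral and cut-free, so the sequent lies in whatever candidate the hypothesis denotes.\<close>
  have "\<forall>A \<in> set \<Gamma>. (\<Gamma>, subst_form Var A) \<in> den ?V M \<phi> A"
    using wf(2) by (auto intro!: candidates_ncf[OF cand] intro: ncf_Axiom form_cong_refl)
  then have "(\<Gamma>, B) \<in> den ?V M \<phi> B"
    using soundness[OF assms(2) M \<pi> \<phi> wf_subst_Var wf(2)] by simp
  then have "(\<Gamma>, B) \<in> cf_sequents L R"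
    by (rule candidates_cf[OF cand[OF wf(1)]])
  then show ?thesis by (simp add: cf_sequents_def)
qed

end
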